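(* For all integers $n \geq 3$ and all $\varepsilon > 0$, there exists a constant $C_{n,\varepsilon} > 0$ such that $$\|M^{\delta}f\|_{L^2(\mathbb{R}^n)} \leq C_{n,\varepsilon}\, \delta^{-\varepsilon} \|f\|_{L^2(\mathbb{R}^n)}$$ holds for all $0 < \delta < 1$ and all $f \in L^2(\mathbb{R}^n)$.
   Context: For $x\in\mathbb{R}^n$ and $\mathbf{r}=(r_1,\dots,r_n)\in(0,\infty)^n$ let $F_{x,\mathbf{r}}(y) := \sum_{j=1}^n \frac{(y_j-x_j)^2}{r_j^2} - 1$ for $y \in \mathbb{R}^n$. For $\delta>0$ define the ellipsoidal annulus $E^{\delta}(x,\mathbf{r}) := \{y\in\mathbb{R}^n : |F_{x,\mathbf{r}}(y)|<\delta\}$. Define the maximal operator $$M^{\delta}f(x) := \sup_{\mathbf{r}\in[1,2]^n} \frac{1}{|E^{\delta}(x,\mathbf{r})|}\int_{E^{\delta}(x,\mathbf{r})}|f|,$$ where $|\cdot|$ applied to a set denotes Lebesgue measure. *)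

theory Defs
  imports "HOL-Analysis.Analysis"
begin

definition ellipsoid_fun :: "real ^ 'n \<Rightarrow> real ^ 'n \<Rightarrow> real ^ 'n \<Rightarrow> real" where
  "ellipsoid_fun x r y = (\<Sum>j\<in>UNIV. (y $ j - x $ j)\<^sup>2 / (r $ j)\<^sup>2) - 1"

definition ellipsoidal_annulus :: "real \<Rightarrow> real ^ 'n \<Rightarrow> real ^ 'n \<Rightarrow> (real ^ 'n) set" where
  "ellipsoidal_annulus \<delta> x r = {y. \<bar>ellipsoid_fun x r y\<bar> < \<delta>}"

text \<open>For \<open>\<delta> > 0\<close> and positive radii the annulus is a nonempty bounded open set, so the
  division below is by a positive finite number.  The supremum itself may be infinite at a point,
  hence the values in \<^typ>\<open>ennreal\<close>.\<close>

definition ellipsoidal_maximal ::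
    "real \<Rightarrow> (real ^ 'n \<Rightarrow> complex) \<Rightarrow> real ^ 'n \<Rightarrow> ennreal" where
  "ellipsoidal_maximal \<delta> f x =
     (SUP r \<in> {r. \<forall>j. r $ j \<in> {1..2}}.
        (\<integral>\<^sup>+ y \<in> ellipsoidal_annulus \<delta> x r. ennreal (norm (f y)) \<partial>lebesgue)
          / emeasure lebesgue (ellipsoidal_annulus \<delta> x r))"

definition sqrt_ennreal :: "ennreal \<Rightarrow> ennreal" where
  "sqrt_ennreal a = (if a = \<infinity> then \<infinity> else ennreal (sqrt (enn2real a)))"

text \<open>The \<open>L\<^sup>2\<close> norm of a nonnegative extended-real function; a complex function \<open>f\<close> enters
  through \<open>\<bar>f\<bar>\<close>.  Functions are not identified up to null sets.\<close>

definition L2_norm :: "(real ^ 'n \<Rightarrow> ennreal) \<Rightarrow> ennreal" where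
  "L2_norm g = sqrt_ennreal (\<integral>\<^sup>+ x. (g x)\<^sup>2 \<partial>lebesgue)"

definition L2_space :: "(real ^ 'n \<Rightarrow> complex) set" where
  "L2_space = {f \<in> borel_measurable lebesgue. integrable lebesgue (\<lambda>x. (norm (f x))\<^sup>2)}"

end

theory Submission
  imports Defs
begin

text \<open>
  Cover the annulus by the pieces on which the \<open>i\<close>-th term of \<open>F\<close> is at least \<open>(1 - \<delta>) / n\<close>. For a
  fixed \<open>i\<close> choose two further coordinates \<open>j\<close>, \<open>k\<close> (here \<open>n \<ge> 3\<close> enters) and let the centre move
  only in the \<open>j\<close>, \<open>k\<close> plane. If \<open>x\<close>, \<open>x'\<close> differ only in these coordinates and \<open>r\<close>, \<open>r'\<close> are
  arbitrary, then \<open>F\<^bsub>x,r\<^esub> / r'\<^sub>i\<^sup>2 - F\<^bsub>x',r'\<^esub> / r\<^sub>i\<^sup>2\<close> does not depend on \<open>y\<^sub>i\<close>, and as a function of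
  \<open>(y\<^sub>j, y\<^sub>k)\<close> it is a sum of two quadratic polynomials in one variable whose linear coefficients are
  comparable to \<open>\<bar>x\<^sub>j - x'\<^sub>j\<bar>\<close> and \<open>\<bar>x\<^sub>k - x'\<^sub>k\<bar>\<close>. Writing \<open>t\<^sub>j\<close>, \<open>t\<^sub>k\<close> for these
  two distances, the pieces therefore meet in a set of measure at most a constant times
  \<open>\<delta>\<^sup>2 (1 / (t\<^sub>j + \<delta>) + 1 / (t\<^sub>k + \<delta>) + log (1 / \<delta>) / sqrt (t\<^sub>j t\<^sub>k))\<close>, uniformly in the
  radii, however degenerate the tangency. The integral of this kernel over a unit square is at most about \<open>\<delta>\<^sup>2 log (1 / \<delta>)\<close>, so Schur's test
  gives the \<open>L\<^sup>2\<close> bound with a logarithmic loss on every unit square parallel to the \<open>j\<close>, \<open>k\<close> plane,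
  and averaging over all such squares gives it on the whole space.
\<close>

section \<open>Sublevel sets of quadratic polynomials\<close>

lemma emeasure_le_of_dist_le:
  fixes S :: "real set"
  assumes "\<And>u v. u \<in> S \<Longrightarrow> v \<in> S \<Longrightarrow> \<bar>u - v\<bar> \<le> D" "0 \<le> D"
  shows "emeasure lborel S \<le> ennreal (2 * D)"
proof (cases "S = {}")
  case False
  then obtain w where w: "w \<in> S" by auto
  have "S \<subseteq> {w - D..w + D}"
    using assms(1)[OF _ w] by force
  then have "emeasure lborel S \<le> emeasure lborel {w - D..w + D}"
    by (intro emeasure_mono) auto
  also have "\<dots> = ennreal (2 * D)"
    using assms(2) by simp
  finally show ?thesis .
qed simp

text \<open>A sublevel set of a quadratic with vertex \<open>-h\<close> can have two components far
  apart, so a diameter bound is available only on each side of the vertex; the set is cut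
  there.\<close>

lemma emeasure_le_of_dist_le_sides:
  fixes S :: "real set"
  assumes "\<And>u v. u \<in> S \<Longrightarrow> v \<in> S \<Longrightarrow> 0 \<le> u + h \<Longrightarrow> 0 \<le> v + h \<Longrightarrow> \<bar>u - v\<bar> \<le> D"
    and "\<And>u v. u \<in> S \<Longrightarrow> v \<in> S \<Longrightarrow> u + h \<le> 0 \<Longrightarrow> v + h \<le> 0 \<Longrightarrow> \<bar>u - v\<bar> \<le> D"
    and "0 \<le> D" and S: "S \<in> sets borel"
  shows "emeasure lborel S \<le> ennreal (4 * D)"
proof -
  let ?P = "S \<inter> {-h..}" and ?N = "S \<inter> {..-h}"
  have "emeasure lborel S \<le> emeasure lborel (?P \<union> ?N)"
    using S by (intro emeasure_mono) auto
  also have "\<dots> \<le> emeasure lborel ?P + emeasure lborel ?N"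
    using S by (intro emeasure_subadditive) auto
  also have "\<dots> \<le> ennreal (2 * D) + ennreal (2 * D)"
    using assms by (intro add_mono emeasure_le_of_dist_le) auto
  also have "\<dots> = ennreal (4 * D)"
    using assms(3) by (simp flip: ennreal_plus)
  finally show ?thesis .
qed

text \<open>Two estimates for \<open>D = \<bar>u - v\<bar>\<close> are merged. Equal signs give
  \<open>D \<le> \<bar>u + v\<bar>\<close>, hence \<open>D^2 \<le> 2 * e\<close>, which is the right
  size for small \<open>\<sigma>\<close>. For large \<open>\<sigma>\<close> the factor
  \<open>\<bar>u + v\<bar>\<close> is at least about \<open>sqrt \<sigma>\<close>, and it divides
  the difference of squares, which is at most \<open>2 * e\<close>.\<close>

lemma dist_le_of_square_close:
  fixes u v \<sigma> e :: real
  assumes "\<bar>u\<^sup>2 - \<sigma>\<bar> \<le> e" "\<bar>v\<^sup>2 - \<sigma>\<bar> \<le> e" "0 \<le> u * v" "0 < e"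
  shows "\<bar>u - v\<bar> \<le> sqrt 6 * e / sqrt (\<bar>\<sigma>\<bar> + e)"
proof -
  define D where "D = \<bar>u - v\<bar>"
  have le: "\<bar>u\<^sup>2 - v\<^sup>2\<bar> \<le> 2 * e" using assms by linarith
  have sq: "(u + v)\<^sup>2 \<ge> u\<^sup>2 + v\<^sup>2" using assms by (simp add: power2_sum)
  have "D \<le> \<bar>u + v\<bar>"
    unfolding D_def using assms(3)
    by (intro abs_le_square_iff[THEN iffD2]) (simp add: power2_sum power2_diff)
  have prod: "D * \<bar>u + v\<bar> \<le> 2 * e"
    using le unfolding D_def by (simp add: power2_eq_square square_diff_square_factored abs_mult mult.commute)
  have "D\<^sup>2 \<le> D * \<bar>u + v\<bar>"
    unfolding power2_eq_square using \<open>D \<le> \<bar>u + v\<bar>\<close> by (intro mult_left_mono) (auto simp: D_def)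
  then have 1: "D\<^sup>2 \<le> 2 * e" using prod by simp
  have "(D * \<bar>u + v\<bar>)\<^sup>2 \<le> (2 * e)\<^sup>2"
    using prod by (intro power_mono) (auto simp: D_def)
  then have 2: "D\<^sup>2 * (u + v)\<^sup>2 \<le> 4 * e\<^sup>2"
    by (simp add: power_mult_distrib)
  \<comment> \<open>For negative \<open>\<sigma>\<close>, \<open>u^2 - \<sigma> \<le> e\<close>
    forces \<open>\<bar>\<sigma>\<bar> \<le> e\<close>, so the left-hand sides are at most
    0.\<close>
  have "\<bar>\<sigma>\<bar> - e \<le> u\<^sup>2" "\<bar>\<sigma>\<bar> - e \<le> v\<^sup>2"
    using assms zero_le_power2[of u] zero_le_power2[of v] by (smt (verit))+
  then have "2 * \<bar>\<sigma>\<bar> - 2 * e \<le> (u + v)\<^sup>2" using sq by linarith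
  then have "D\<^sup>2 * (2 * \<bar>\<sigma>\<bar> - 2 * e) \<le> 4 * e\<^sup>2"
    using 2 by (meson mult_left_mono order_trans zero_le_power2)
  \<comment> \<open>The weight \<open>4 * e\<close> turns the \<open>- 2 * e\<close> of the
    preceding bound into \<open>+ 2 * e\<close>.\<close>
  moreover have "D\<^sup>2 * (4 * e) \<le> 2 * e * (4 * e)"
    using 1 assms(4) by (intro mult_right_mono) auto
  ultimately have "D\<^sup>2 * (2 * \<bar>\<sigma>\<bar> + 2 * e) \<le> 12 * e\<^sup>2"
    by (simp add: algebra_simps power2_eq_square)
  then have "D\<^sup>2 * (\<bar>\<sigma>\<bar> + e) \<le> 6 * e\<^sup>2"
    by (simp add: algebra_simps)
  then have "sqrt (D\<^sup>2 * (\<bar>\<sigma>\<bar> + e)) \<le> sqrt (6 * e\<^sup>2)"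
    by (rule real_sqrt_le_mono)
  then have "D * sqrt (\<bar>\<sigma>\<bar> + e) \<le> sqrt 6 * e"
    using assms(4) by (simp add: real_sqrt_mult D_def)
  then show ?thesis
    using assms(4) by (simp add: D_def pos_le_divide_eq add_nonneg_pos)
qed

text \<open>After division by \<open>A\<close> the preceding bound applies on each side of the
  vertex, and \<open>4 * sqrt 6\<close> is rounded up to 10. The bound covers all levels at once:
  order \<open>sqrt \<eta>\<close> at \<open>\<tau> = 0\<close>, decaying like
  \<open>\<eta> / sqrt \<bar>\<tau>\<bar>\<close> away from it.\<close>

lemma emeasure_square_sublevel:
  fixes A h \<tau> \<eta> :: real
  assumes "A \<noteq> 0" "0 < \<eta>"
  shows "emeasure lborel {b. \<bar>A * (b + h)\<^sup>2 - \<tau>\<bar> \<le> \<eta>}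
    \<le> ennreal (10 * \<eta> / (sqrt \<bar>A\<bar> * sqrt (\<bar>\<tau>\<bar> + \<eta>)))"
proof -
  let ?S = "{b. \<bar>A * (b + h)\<^sup>2 - \<tau>\<bar> \<le> \<eta>}"
  define D where "D = sqrt 6 * (\<eta> / \<bar>A\<bar>) / sqrt (\<bar>\<tau> / A\<bar> + \<eta> / \<bar>A\<bar>)"
  have close: "\<bar>(b + h)\<^sup>2 - \<tau> / A\<bar> \<le> \<eta> / \<bar>A\<bar>" if "b \<in> ?S" for b
  proof -
    have "A * (b + h)\<^sup>2 - \<tau> = A * ((b + h)\<^sup>2 - \<tau> / A)"
      using assms(1) by (simp add: field_simps)
    then have "\<bar>A\<bar> * \<bar>(b + h)\<^sup>2 - \<tau> / A\<bar> \<le> \<eta>"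
      using that by (simp add: abs_mult)
    then show ?thesis using assms(1) by (simp add: field_simps)
  qed
  have D: "\<bar>u - v\<bar> \<le> D" if "u \<in> ?S" "v \<in> ?S" "0 \<le> (u + h) * (v + h)" for u v
    using dist_le_of_square_close[OF close[OF that(1)] close[OF that(2)] that(3)] assms
    by (simp add: D_def)
  have "emeasure lborel ?S \<le> ennreal (4 * D)"
  proof (rule emeasure_le_of_dist_le_sides[where h = h])
    show "?S \<in> sets borel" by measurable
    show "0 \<le> D" unfolding D_def using assms by (intro divide_nonneg_nonneg mult_nonneg_nonneg) auto
  qed (use D in \<open>auto simp: zero_le_mult_iff\<close>)
  also have "4 * D \<le> 10 * \<eta> / (sqrt \<bar>A\<bar> * sqrt (\<bar>\<tau>\<bar> + \<eta>))"
  proof -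
    have "\<bar>\<tau> / A\<bar> + \<eta> / \<bar>A\<bar> = (\<bar>\<tau>\<bar> + \<eta>) / \<bar>A\<bar>"
      by (simp add: add_divide_distrib)
    then have "D = sqrt 6 * \<eta> / (sqrt \<bar>A\<bar> * sqrt (\<bar>\<tau>\<bar> + \<eta>))"
      using assms unfolding D_def
      by (simp add: real_sqrt_divide field_simps flip: power2_eq_square)
    moreover have "4 * sqrt 6 \<le> (10 :: real)"
      using real_le_lsqrt[of "5/2" "6 :: real"] by (simp add: power2_eq_square)
    ultimately show ?thesis
      using mult_right_mono[of "4 * sqrt 6" 10 "\<eta> / (sqrt \<bar>A\<bar> * sqrt (\<bar>\<tau>\<bar> + \<eta>))"] assms by simp
  qed
  finally show ?thesis by (simp add: ennreal_leI)
qed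

section \<open>Integrals of reciprocal distances over the unit interval\<close>

text \<open>Moving the centre to the nearest point \<open>c'\<close> of the interval shortens its
  distance to every point of the interval, so \<open>g\<close> only grows. The parts to the left and
  right of \<open>c'\<close> each contribute at most one copy of the integral over
  \<open>{0..1}\<close>.\<close>

lemma nn_integral_unit_interval_dist_le:
  fixes g :: "real \<Rightarrow> real"
  assumes g: "g \<in> borel_measurable borel" 
    and mono: "\<And>u v. 0 < u \<Longrightarrow> u \<le> v \<Longrightarrow> g v \<le> g u"
  shows "(\<integral>\<^sup>+a\<in>{0..1}. ennreal (g \<bar>a - c\<bar>) \<partial>lborel) \<le> 2 * (\<integral>\<^sup>+v\<in>{0..1}. ennreal (g v) \<partial>lborel)"
proof -
  define c' where "c' = max 0 (min 1 c)"
  have c': "0 \<le> c'" "c' \<le> 1" by (auto simp: c'_def)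
  have [measurable]: "g \<in> borel_measurable borel" by fact
  have "(\<integral>\<^sup>+a\<in>{0..1}. ennreal (g \<bar>a - c\<bar>) \<partial>lborel)
      \<le> (\<integral>\<^sup>+a\<in>{0..1}. ennreal (g \<bar>a - c'\<bar>) \<partial>lborel)"
    \<comment> \<open>At \<open>a = c'\<close> the distance becomes 0, where \<open>g\<close> is not
      assumed monotone; this single point is null.\<close>
    using AE_lborel_singleton[of c']
    by (intro nn_integral_mono_AE)
      (auto simp: c'_def max_def min_def intro!: ennreal_leI mono split: split_indicator elim!: eventually_mono)
  also have "\<dots> \<le> (\<integral>\<^sup>+a. ennreal (g (a - c')) * indicator {0..1} (a - c')
        + ennreal (g (c' - a)) * indicator {0..1} (c' - a) \<partial>lborel)"
    using c' by (intro nn_integral_mono) (auto split: split_indicator)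
  also have "\<dots> = (\<integral>\<^sup>+a. ennreal (g (a - c')) * indicator {0..1} (a - c') \<partial>lborel)
        + (\<integral>\<^sup>+a. ennreal (g (c' - a)) * indicator {0..1} (c' - a) \<partial>lborel)"
    by (rule nn_integral_add) measurable
  also have "(\<integral>\<^sup>+a. ennreal (g (a - c')) * indicator {0..1} (a - c') \<partial>lborel)
     = (\<integral>\<^sup>+v\<in>{0..1}. ennreal (g v) \<partial>lborel)"
    using nn_integral_real_affine[of "\<lambda>v. ennreal (g v) * indicator {0..1} v" 1 "- c'"] by simp
  also have "(\<integral>\<^sup>+a. ennreal (g (c' - a)) * indicator {0..1} (c' - a) \<partial>lborel)
     = (\<integral>\<^sup>+v\<in>{0..1}. ennreal (g v) \<partial>lborel)"
    using nn_integral_real_affine[of "\<lambda>v. ennreal (g v) * indicator {0..1} v" "-1" "c'"] by simp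
  finally show ?thesis by (simp add: mult_2)
qed

lemma nn_integral_inverse_dist_le:
  fixes \<kappa> c :: real
  assumes "0 < \<kappa>"
  shows "(\<integral>\<^sup>+a\<in>{0..1}. ennreal (1 / (\<bar>a - c\<bar> + \<kappa>)) \<partial>lborel) \<le> ennreal (2 * ln (1 + 1 / \<kappa>))"
proof -
  have "(\<integral>\<^sup>+a\<in>{0..1}. ennreal (1 / (\<bar>a - c\<bar> + \<kappa>)) \<partial>lborel)
     = (\<integral>\<^sup>+a\<in>{0..1}. ennreal ((\<lambda>v. 1 / (max 0 v + \<kappa>)) \<bar>a - c\<bar>) \<partial>lborel)"
    by (simp add: max_def)
  also have "\<dots> \<le> 2 * (\<integral>\<^sup>+v\<in>{0..1}. ennreal (1 / (max 0 v + \<kappa>)) \<partial>lborel)"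
    using assms by (intro nn_integral_unit_interval_dist_le) (auto intro!: divide_left_mono simp: max_def)
  also have "(\<integral>\<^sup>+v\<in>{0..1}. ennreal (1 / (max 0 v + \<kappa>)) \<partial>lborel)
     = (\<integral>\<^sup>+v. ennreal (1 / (v + \<kappa>)) * indicator {0..1} v \<partial>lborel)"
    by (intro nn_integral_cong) (auto split: split_indicator)
  also have "\<dots> = ennreal (ln (1 + \<kappa>) - ln (0 + \<kappa>))"
    using assms by (intro nn_integral_FTC_Icc) (auto intro!: derivative_eq_intros)
  also have "ln (1 + \<kappa>) - ln (0 + \<kappa>) = ln (1 + 1 / \<kappa>)"
    using assms ln_div[of "1 + \<kappa>" \<kappa>] by (simp add: add_divide_distrib add.commute)
  finally show ?thesis
    using assms by (simp add: ennreal_mult)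
qed

lemma nn_integral_inverse_sqrt_dist_le:
  "(\<integral>\<^sup>+a\<in>{0..1}. ennreal (1 / sqrt \<bar>a - c\<bar>) \<partial>lborel) \<le> 4"
proof -
  have "(\<integral>\<^sup>+a\<in>{0..1}. ennreal (1 / sqrt \<bar>a - c\<bar>) \<partial>lborel)
      \<le> 2 * (\<integral>\<^sup>+v\<in>{0..1}. ennreal (1 / sqrt v) \<partial>lborel)"
    by (intro nn_integral_unit_interval_dist_le) (auto intro!: divide_left_mono)
  also have "(\<integral>\<^sup>+v\<in>{0..1}. ennreal (1 / sqrt v) \<partial>lborel) = ennreal 2"
  proof -
    have "((\<lambda>v::real. v powr (-1/2)) has_integral 2) {0..1}"
      using has_integral_powr_from_0[of "-1/2" 1] by simp
    then have "((\<lambda>v::real. 1 / sqrt v) has_integral 2) {0..1}"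
      by (rule has_integral_eq[rotated]) (auto simp: powr_minus_divide powr_half_sqrt)
    then show ?thesis
      by (intro nn_integral_has_integral_lebesgue') auto
  qed
  finally show ?thesis by simp
qed

text \<open>With \<open>d\<close> the distance from \<open>w\<close> to the nearer of
  \<open>m\<close> and \<open>-m\<close>, factoring gives
  \<open>d^2 \<le> \<bar>w^2 - \<sigma>\<bar>\<close>; for negative \<open>\<sigma>\<close> both
  points sit at 0. This converts slice lengths into reciprocal distances, which integrate to
  logarithms. Adding both terms avoids tracking which point is nearer.\<close>

lemma quotient_sqrt_le_sum_inverse_dist:
  fixes w \<sigma> \<kappa> :: real
  assumes "0 < \<kappa>"
  defines "m \<equiv> sqrt (max 0 \<sigma>)"
  shows "1 / sqrt (\<bar>w\<^sup>2 - \<sigma>\<bar> + \<kappa>\<^sup>2) \<le> 2 * (1 / (\<bar>w - m\<bar> + \<kappa>) + 1 / (\<bar>w + m\<bar> + \<kappa>))"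
proof -
  define d where "d = min \<bar>w - m\<bar> \<bar>w + m\<bar>"
  have "0 \<le> m" by (simp add: m_def)
  have d0: "0 \<le> d" by (simp add: d_def)
  have d: "d\<^sup>2 \<le> \<bar>w\<^sup>2 - \<sigma>\<bar>"
  proof (cases "0 \<le> \<sigma>")
    case True
    then have "m\<^sup>2 = \<sigma>" by (simp add: m_def)
    then have "w\<^sup>2 - \<sigma> = (w - m) * (w + m)"
      by (simp add: power2_eq_square algebra_simps)
    then have "\<bar>w\<^sup>2 - \<sigma>\<bar> = \<bar>w - m\<bar> * \<bar>w + m\<bar>"
      by (simp add: abs_mult)
    then show ?thesis
      unfolding power2_eq_square by (auto intro!: mult_mono simp: d_def)
  next
    case False
    then have "d = \<bar>w\<bar>" by (simp add: d_def m_def)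
    then show ?thesis using False by simp
  qed
  have "(d + \<kappa>)\<^sup>2 \<le> 4 * (d\<^sup>2 + \<kappa>\<^sup>2)"
    using zero_le_power2[of "d - \<kappa>"] zero_le_power2[of d] zero_le_power2[of \<kappa>]
    unfolding power2_sum power2_diff by argo
  also have "\<dots> \<le> 4 * (\<bar>w\<^sup>2 - \<sigma>\<bar> + \<kappa>\<^sup>2)" using d by simp
  finally have "d + \<kappa> \<le> sqrt (4 * (\<bar>w\<^sup>2 - \<sigma>\<bar> + \<kappa>\<^sup>2))"
    by (rule real_le_rsqrt)
  then have "d + \<kappa> \<le> 2 * sqrt (\<bar>w\<^sup>2 - \<sigma>\<bar> + \<kappa>\<^sup>2)"
    by (simp only: real_sqrt_mult real_sqrt_four)
  moreover have "0 < sqrt (\<bar>w\<^sup>2 - \<sigma>\<bar> + \<kappa>\<^sup>2)"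
    using assms(1) by (simp add: add_nonneg_pos)
  ultimately have "1 / sqrt (\<bar>w\<^sup>2 - \<sigma>\<bar> + \<kappa>\<^sup>2) \<le> 2 * (1 / (d + \<kappa>))"
    using assms(1) d0 by (simp add: field_simps)
  also have "1 / (d + \<kappa>) \<le> 1 / (\<bar>w - m\<bar> + \<kappa>) + 1 / (\<bar>w + m\<bar> + \<kappa>)"
    using assms(1) by (auto simp: d_def min_def)
  finally show ?thesis by simp
qed

section \<open>Sublevel sets in two variables\<close>

text \<open>For fixed \<open>a\<close> the slice in \<open>b\<close> is a sublevel set of a pure
  square whose level is quadratic in \<open>a\<close>. Slices are long only near the at most two
  zeros of that level, and the resulting reciprocal distances, truncated at
  \<open>sqrt \<eta>\<close>, integrate to a single logarithm.\<close>

lemma nn_integral_quadratic_sublevel: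
  fixes A1 A2 h1 h2 c \<eta> :: real
  assumes "A1 \<noteq> 0" "A2 \<noteq> 0" "\<bar>A1\<bar> \<le> 1" "0 < \<eta>"
  shows "(\<integral>\<^sup>+a\<in>{0..1}. emeasure lborel {b. \<bar>A1 * (a + h1)\<^sup>2 + A2 * (b + h2)\<^sup>2 + c\<bar> \<le> \<eta>} \<partial>lborel)
    \<le> ennreal (80 * \<eta> * ln (1 + 1 / sqrt \<eta>) / (sqrt \<bar>A1\<bar> * sqrt \<bar>A2\<bar>))"
proof -
  define \<sigma> where "\<sigma> = - c / A1"
  define m where "m = sqrt (max 0 \<sigma>)"
  \<comment> \<open>Here 20 is 10 from the slice bound times 2 from
    \<open>quotient_sqrt_le_sum_inverse_dist\<close>. Two points with \<open>2 * ln\<close> each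
    later make it 80.\<close>
  define k where "k = 20 * \<eta> / (sqrt \<bar>A1\<bar> * sqrt \<bar>A2\<bar>)"
  have k: "0 \<le> k" using assms by (simp add: k_def)
  have inner: "emeasure lborel {b. \<bar>A1 * (a + h1)\<^sup>2 + A2 * (b + h2)\<^sup>2 + c\<bar> \<le> \<eta>}
      \<le> ennreal k * (ennreal (1 / (\<bar>a - (m - h1)\<bar> + sqrt \<eta>)) + ennreal (1 / (\<bar>a - (- m - h1)\<bar> + sqrt \<eta>)))"
    for a
  proof -
    let ?\<tau> = "- (A1 * (a + h1)\<^sup>2 + c)"
    have "\<bar>A1 * (a + h1)\<^sup>2 + A2 * (b + h2)\<^sup>2 + c\<bar> = \<bar>A2 * (b + h2)\<^sup>2 - ?\<tau>\<bar>" for b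
      by (simp add: algebra_simps)
    then have "emeasure lborel {b. \<bar>A1 * (a + h1)\<^sup>2 + A2 * (b + h2)\<^sup>2 + c\<bar> \<le> \<eta>}
       \<le> ennreal (10 * \<eta> / (sqrt \<bar>A2\<bar> * sqrt (\<bar>?\<tau>\<bar> + \<eta>)))"
      using emeasure_square_sublevel[OF assms(2,4), of h2 ?\<tau>] by simp
    also have "\<dots> \<le> ennreal (k * (1 / (\<bar>(a + h1) - m\<bar> + sqrt \<eta>) + 1 / (\<bar>(a + h1) + m\<bar> + sqrt \<eta>)))"
    proof (rule ennreal_leI)
      have "\<bar>?\<tau>\<bar> = \<bar>A1\<bar> * \<bar>(a + h1)\<^sup>2 - \<sigma>\<bar>"
        using assms(1) by (simp add: \<sigma>_def field_simps flip: abs_mult)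
      \<comment> \<open>The bound \<open>\<bar>A1\<bar> \<le> 1\<close> allows
        \<open>\<bar>A1\<bar>\<close> to be factored out of the summand \<open>\<eta>\<close>
        too.\<close>
      moreover have "\<bar>A1\<bar> * \<eta> \<le> \<eta>"
        using assms by simp
      ultimately have "\<bar>A1\<bar> * (\<bar>(a + h1)\<^sup>2 - \<sigma>\<bar> + \<eta>) \<le> \<bar>?\<tau>\<bar> + \<eta>"
        by (simp add: algebra_simps)
      then have "sqrt \<bar>A1\<bar> * sqrt (\<bar>(a + h1)\<^sup>2 - \<sigma>\<bar> + \<eta>) \<le> sqrt (\<bar>?\<tau>\<bar> + \<eta>)"
        by (metis real_sqrt_le_mono real_sqrt_mult)
      then have "10 * \<eta> / (sqrt \<bar>A2\<bar> * sqrt (\<bar>?\<tau>\<bar> + \<eta>))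
        \<le> 10 * \<eta> / (sqrt \<bar>A2\<bar> * (sqrt \<bar>A1\<bar> * sqrt (\<bar>(a + h1)\<^sup>2 - \<sigma>\<bar> + \<eta>)))"
        using assms by (intro divide_left_mono mult_left_mono mult_pos_pos) (auto simp: add_nonneg_pos)
      also have "\<dots> = k / 2 * (1 / sqrt (\<bar>(a + h1)\<^sup>2 - \<sigma>\<bar> + (sqrt \<eta>)\<^sup>2))"
        using assms by (simp add: k_def field_simps)
      also have "\<dots> \<le> k / 2 * (2 * (1 / (\<bar>(a + h1) - m\<bar> + sqrt \<eta>) + 1 / (\<bar>(a + h1) + m\<bar> + sqrt \<eta>)))"
        unfolding m_def using assms k
        by (intro mult_left_mono quotient_sqrt_le_sum_inverse_dist) auto
      also have "\<dots> = k * (1 / (\<bar>(a + h1) - m\<bar> + sqrt \<eta>) + 1 / (\<bar>(a + h1) + m\<bar> + sqrt \<eta>))"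
        by (simp only: mult.assoc[symmetric] times_divide_eq_left nonzero_mult_div_cancel_right[OF zero_neq_numeral[symmetric]])
      finally show "10 * \<eta> / (sqrt \<bar>A2\<bar> * sqrt (\<bar>?\<tau>\<bar> + \<eta>))
        \<le> k * (1 / (\<bar>(a + h1) - m\<bar> + sqrt \<eta>) + 1 / (\<bar>(a + h1) + m\<bar> + sqrt \<eta>))" .
    qed
    also have "\<dots> = ennreal k * (ennreal (1 / (\<bar>(a + h1) - m\<bar> + sqrt \<eta>)) + ennreal (1 / (\<bar>(a + h1) + m\<bar> + sqrt \<eta>)))"
    proof -
      have "ennreal (k * (p + q)) = ennreal k * (ennreal p + ennreal q)" if "0 \<le> p" "0 \<le> q" for p q
        using that k by (simp add: ennreal_mult)
      then show ?thesis using assms(4) by simp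
    qed
    also have "(a + h1) - m = a - (m - h1)" by simp
    also have "(a + h1) + m = a - (- m - h1)" by simp
    finally show ?thesis .
  qed
  have "(\<integral>\<^sup>+a\<in>{0..1}. emeasure lborel {b. \<bar>A1 * (a + h1)\<^sup>2 + A2 * (b + h2)\<^sup>2 + c\<bar> \<le> \<eta>} \<partial>lborel)
    \<le> (\<integral>\<^sup>+a. ennreal k * (ennreal (1 / (\<bar>a - (m - h1)\<bar> + sqrt \<eta>)) * indicator {0..1} a
        + ennreal (1 / (\<bar>a - (- m - h1)\<bar> + sqrt \<eta>)) * indicator {0..1} a) \<partial>lborel)"
    using inner by (intro nn_integral_mono) (auto split: split_indicator)
  also have "\<dots> = ennreal k * ((\<integral>\<^sup>+a\<in>{0..1}. ennreal (1 / (\<bar>a - (m - h1)\<bar> + sqrt \<eta>)) \<partial>lborel)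
        + (\<integral>\<^sup>+a\<in>{0..1}. ennreal (1 / (\<bar>a - (- m - h1)\<bar> + sqrt \<eta>)) \<partial>lborel))"
    by (subst nn_integral_cmult, measurable, subst nn_integral_add, measurable)
  also have "\<dots> \<le> ennreal k * (ennreal (2 * ln (1 + 1 / sqrt \<eta>)) + ennreal (2 * ln (1 + 1 / sqrt \<eta>)))"
    using assms by (intro mult_left_mono add_mono nn_integral_inverse_dist_le) auto
  also have "\<dots> = ennreal k * ennreal (4 * ln (1 + 1 / sqrt \<eta>))"
    by (subst ennreal_plus[symmetric]) (use assms in auto)
  also have "\<dots> = ennreal (k * (4 * ln (1 + 1 / sqrt \<eta>)))"
    by (rule ennreal_mult[symmetric]) (use assms k in auto)
  also have "k * (4 * ln (1 + 1 / sqrt \<eta>)) = 80 * \<eta> * ln (1 + 1 / sqrt \<eta>) / (sqrt \<bar>A1\<bar> * sqrt \<bar>A2\<bar>)"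
    by (simp add: k_def)
  finally show ?thesis .
qed

text \<open>On \<open>\<bar>\<zeta> + b\<bar> \<le> 3\<close> a chord slope differs from
  \<open>B\<close> by at most \<open>6 * \<bar>A\<bar> \<le> \<bar>B\<bar> / 2\<close>, so the
  polynomial separates points at rate at least \<open>\<bar>B\<bar> / 2\<close>. If
  \<open>\<eta> > t\<close> the right-hand side exceeds 64 and the length of the unit interval
  suffices.\<close>

lemma emeasure_nearly_linear_sublevel:
  fixes A B \<zeta> c \<eta> t :: real
  assumes "\<bar>A\<bar> \<le> \<bar>B\<bar> / 12" "t / 8 \<le> \<bar>B\<bar>" "0 < t" "0 < \<eta>"
  shows "emeasure lborel {b \<in> {0..1}. \<bar>\<zeta> + b\<bar> \<le> 3 \<and> \<bar>A * (\<zeta> + b)\<^sup>2 + B * (\<zeta> + b) + c\<bar> \<le> \<eta>}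
    \<le> ennreal (128 * \<eta> / (t + \<eta>))"
    (is "emeasure lborel ?S \<le> _")
proof (cases "\<eta> \<le> t")
  case True
  have B: "0 < \<bar>B\<bar>" using assms by linarith
  have "emeasure lborel ?S \<le> ennreal (2 * (32 * \<eta> / t))"
  proof (rule emeasure_le_of_dist_le)
    fix u v assume uv: "u \<in> ?S" "v \<in> ?S"
    have "\<bar>A * ((\<zeta> + u) + (\<zeta> + v))\<bar> \<le> (\<bar>B\<bar> / 12) * 6"
      unfolding abs_mult using uv assms(1) by (intro mult_mono) auto
    then have "\<bar>B\<bar> / 2 \<le> \<bar>A * ((\<zeta> + u) + (\<zeta> + v)) + B\<bar>" by linarith
    then have "\<bar>u - v\<bar> * (\<bar>B\<bar> / 2) \<le> \<bar>u - v\<bar> * \<bar>A * ((\<zeta> + u) + (\<zeta> + v)) + B\<bar>"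
      by (intro mult_left_mono) auto
    also have "\<dots> = \<bar>(A * (\<zeta> + u)\<^sup>2 + B * (\<zeta> + u) + c) - (A * (\<zeta> + v)\<^sup>2 + B * (\<zeta> + v) + c)\<bar>"
      by (simp add: algebra_simps power2_eq_square flip: abs_mult)
    also have "\<dots> \<le> 2 * \<eta>" using uv by (auto simp: abs_le_iff)
    finally have "\<bar>u - v\<bar> * \<bar>B\<bar> \<le> 4 * \<eta>" by simp
    moreover have "\<bar>u - v\<bar> * (t / 8) \<le> \<bar>u - v\<bar> * \<bar>B\<bar>"
      using assms by (intro mult_left_mono) auto
    ultimately have "\<bar>u - v\<bar> * t \<le> 32 * \<eta>" by simp
    then show "\<bar>u - v\<bar> \<le> 32 * \<eta> / t"
      using assms by (simp add: field_simps)
  qed (use assms in auto)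
  also have "2 * (32 * \<eta> / t) \<le> 128 * \<eta> / (t + \<eta>)"
    using assms True by (simp add: field_simps)
  finally show ?thesis by (simp add: ennreal_leI)
next
  case False
  have "emeasure lborel ?S \<le> emeasure lborel {0..1::real}"
    by (intro emeasure_mono) auto
  also have "\<dots> = ennreal 1" by simp
  also have "\<dots> \<le> ennreal (128 * \<eta> / (t + \<eta>))"
    using False assms by (intro ennreal_leI) (simp add: field_simps)
  finally show ?thesis .
qed

text \<open>Here \<open>a\<close> and \<open>b\<close> are displacements along two axes,
  \<open>\<zeta>1\<close> and \<open>\<zeta>2\<close> the offsets of the base point from the centre.
  The bounds by 3 are those that membership in an annulus imposes on each coordinate.\<close>

definition planar_sublevel ::
    "real \<Rightarrow> real \<Rightarrow> real \<Rightarrow> real \<Rightarrow> real \<Rightarrow> real \<Rightarrow> real \<Rightarrow> real \<Rightarrow> (real \<times> real) set" where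
  "planar_sublevel A1 B1 \<zeta>1 A2 B2 \<zeta>2 c \<eta> = {(a, b). a \<in> {0..1} \<and> b \<in> {0..1} \<and> \<bar>\<zeta>1 + a\<bar> \<le> 3 \<and> \<bar>\<zeta>2 + b\<bar> \<le> 3 \<and>
     \<bar>A1 * (\<zeta>1 + a)\<^sup>2 + B1 * (\<zeta>1 + a) + (A2 * (\<zeta>2 + b)\<^sup>2 + B2 * (\<zeta>2 + b)) + c\<bar> \<le> \<eta>}"

lemma planar_sublevel_measurable [measurable]:
  "planar_sublevel A1 B1 \<zeta>1 A2 B2 \<zeta>2 c \<eta> \<in> sets (borel \<Otimes>\<^sub>M borel)"
proof -
  have "planar_sublevel A1 B1 \<zeta>1 A2 B2 \<zeta>2 c \<eta> = {p \<in> space (borel \<Otimes>\<^sub>M borel). 0 \<le> fst p \<and> fst p \<le> 1 \<and> 0 \<le> snd p \<and> snd p \<le> 1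
     \<and> \<bar>\<zeta>1 + fst p\<bar> \<le> 3 \<and> \<bar>\<zeta>2 + snd p\<bar> \<le> 3 \<and>
     \<bar>A1 * (\<zeta>1 + fst p)\<^sup>2 + B1 * (\<zeta>1 + fst p) + (A2 * (\<zeta>2 + snd p)\<^sup>2 + B2 * (\<zeta>2 + snd p)) + c\<bar> \<le> \<eta>}"
    by (auto simp: planar_sublevel_def space_pair_measure)
  then show ?thesis by simp
qed

lemma planar_sublevel_swap:
  "(b, a) \<in> planar_sublevel A2 B2 \<zeta>2 A1 B1 \<zeta>1 c \<eta> \<longleftrightarrow> (a, b) \<in> planar_sublevel A1 B1 \<zeta>1 A2 B2 \<zeta>2 c \<eta>"
  by (auto simp: planar_sublevel_def algebra_simps)

lemma nn_integral_planar_sublevel_linear: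
  fixes A1 B1 \<zeta>1 A2 B2 \<zeta>2 c \<eta> t2 :: real
  assumes "\<bar>A2\<bar> \<le> \<bar>B2\<bar> / 12" "t2 / 8 \<le> \<bar>B2\<bar>" "0 < t2" "0 < \<eta>"
  shows "(\<integral>\<^sup>+a. \<integral>\<^sup>+b. indicator (planar_sublevel A1 B1 \<zeta>1 A2 B2 \<zeta>2 c \<eta>) (a, b) \<partial>lborel \<partial>lborel)
    \<le> ennreal (128 * \<eta> / (t2 + \<eta>))"
proof -
  have inner: "(\<integral>\<^sup>+b. indicator (planar_sublevel A1 B1 \<zeta>1 A2 B2 \<zeta>2 c \<eta>) (a, b) \<partial>lborel)
     \<le> ennreal (128 * \<eta> / (t2 + \<eta>)) * indicator {0..1} a" for a
  proof (cases "a \<in> {0..1}")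
    case True
    let ?c = "A1 * (\<zeta>1 + a)\<^sup>2 + B1 * (\<zeta>1 + a) + c"
    let ?S = "{b \<in> {0..1}. \<bar>\<zeta>2 + b\<bar> \<le> 3 \<and> \<bar>A2 * (\<zeta>2 + b)\<^sup>2 + B2 * (\<zeta>2 + b) + ?c\<bar> \<le> \<eta>}"
    have S: "?S \<in> sets borel" by measurable
    have "(\<integral>\<^sup>+b. indicator (planar_sublevel A1 B1 \<zeta>1 A2 B2 \<zeta>2 c \<eta>) (a, b) \<partial>lborel) \<le> (\<integral>\<^sup>+b. indicator ?S b \<partial>lborel)"
      by (intro nn_integral_mono) (auto simp: planar_sublevel_def algebra_simps split: split_indicator)
    also have "\<dots> = emeasure lborel ?S"
      using S by (intro nn_integral_indicator) simp
    also have "\<dots> \<le> ennreal (128 * \<eta> / (t2 + \<eta>))"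
      by (rule emeasure_nearly_linear_sublevel[OF assms])
    finally show ?thesis using True by simp
  qed (auto simp: planar_sublevel_def)
  have "(\<integral>\<^sup>+a. \<integral>\<^sup>+b. indicator (planar_sublevel A1 B1 \<zeta>1 A2 B2 \<zeta>2 c \<eta>) (a, b) \<partial>lborel \<partial>lborel)
    \<le> (\<integral>\<^sup>+(a::real). ennreal (128 * \<eta> / (t2 + \<eta>)) * indicator {0..1} a \<partial>lborel)"
    by (rule nn_integral_mono) (rule inner)
  also have "\<dots> = ennreal (128 * \<eta> / (t2 + \<eta>)) * emeasure lborel {0..1::real}"
    by (intro nn_integral_cmult_indicator) simp
  finally show ?thesis by simp
qed

text \<open>If one of the two quadratics is nearly linear, integrating first in its variable gives a
  bound without logarithm. Otherwise both leading coefficients are at least comparable to the linear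
  ones, and completing squares leads to \<open>nn_integral_quadratic_sublevel\<close>. The three
  bounds are added so that one formula serves all cases.\<close>

lemma nn_integral_planar_sublevel:
  fixes A1 B1 \<zeta>1 A2 B2 \<zeta>2 c \<eta> t1 t2 :: real
  assumes "\<bar>A1\<bar> \<le> 1" "t1 / 8 \<le> \<bar>B1\<bar>" "t2 / 8 \<le> \<bar>B2\<bar>" "0 < t1" "0 < t2" "0 < \<eta>"
  shows "(\<integral>\<^sup>+a. \<integral>\<^sup>+b. indicator (planar_sublevel A1 B1 \<zeta>1 A2 B2 \<zeta>2 c \<eta>) (a, b) \<partial>lborel \<partial>lborel)
    \<le> ennreal (128 * \<eta> / (t1 + \<eta>) + 128 * \<eta> / (t2 + \<eta>)
        + 8000 * \<eta> * ln (1 + 1 / sqrt \<eta>) / (sqrt t1 * sqrt t2))"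
    (is "?I \<le> ennreal (?X + ?Y + ?Z)")
proof -
  have nonneg: "0 \<le> ?X" "0 \<le> ?Y" "0 \<le> ?Z" using assms by auto
  consider "\<bar>A2\<bar> \<le> \<bar>B2\<bar> / 12" | "\<bar>A1\<bar> \<le> \<bar>B1\<bar> / 12"
    | "\<bar>B1\<bar> / 12 < \<bar>A1\<bar>" "\<bar>B2\<bar> / 12 < \<bar>A2\<bar>" by linarith
  then show ?thesis
  proof cases
    case 1
    have "?I \<le> ennreal ?Y"
      by (rule nn_integral_planar_sublevel_linear[OF 1 assms(3,5,6)])
    also have "\<dots> \<le> ennreal (?X + ?Y + ?Z)" using nonneg by (intro ennreal_leI) linarith
    finally show ?thesis .
  next
    case 2
    \<comment> \<open>The order is exchanged so that the nearly linear variable is the inner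
      one.\<close>
    have "?I = (\<integral>\<^sup>+b. \<integral>\<^sup>+a. indicator (planar_sublevel A1 B1 \<zeta>1 A2 B2 \<zeta>2 c \<eta>) (a, b) \<partial>lborel \<partial>lborel)"
      by (rule lborel_pair.Fubini'[symmetric]) simp
    also have "\<dots> = (\<integral>\<^sup>+b. \<integral>\<^sup>+a. indicator (planar_sublevel A2 B2 \<zeta>2 A1 B1 \<zeta>1 c \<eta>) (b, a) \<partial>lborel \<partial>lborel)"
      by (simp add: indicator_def planar_sublevel_swap[of _ _ A2 B2 \<zeta>2])
    also have "\<dots> \<le> ennreal ?X"
      by (rule nn_integral_planar_sublevel_linear[OF 2 assms(2,4,6)])
    also have "\<dots> \<le> ennreal (?X + ?Y + ?Z)" using nonneg by (intro ennreal_leI) linarith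
    finally show ?thesis .
  next
    case 3
    define h1 where "h1 = \<zeta>1 + B1 / (2 * A1)"
    define h2 where "h2 = \<zeta>2 + B2 / (2 * A2)"
    define c' where "c' = c - B1\<^sup>2 / (4 * A1) - B2\<^sup>2 / (4 * A2)"
    have nz: "A1 \<noteq> 0" "A2 \<noteq> 0" using 3 by auto
    have sq: "A * (\<zeta> + a)\<^sup>2 + B * (\<zeta> + a) = A * (a + (\<zeta> + B / (2 * A)))\<^sup>2 - B\<^sup>2 / (4 * A)"
      if "A \<noteq> 0" for A B \<zeta> a :: real
      using that by (simp add: power2_eq_square field_simps)
    have eq: "A1 * (\<zeta>1 + a)\<^sup>2 + B1 * (\<zeta>1 + a) + (A2 * (\<zeta>2 + b)\<^sup>2 + B2 * (\<zeta>2 + b)) + c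
       = A1 * (a + h1)\<^sup>2 + A2 * (b + h2)\<^sup>2 + c'" for a b
      unfolding sq[OF nz(1)] sq[OF nz(2)] h1_def h2_def c'_def by simp
    have "?I \<le> (\<integral>\<^sup>+a\<in>{0..1}. emeasure lborel {b. \<bar>A1 * (a + h1)\<^sup>2 + A2 * (b + h2)\<^sup>2 + c'\<bar> \<le> \<eta>} \<partial>lborel)"
    proof (rule nn_integral_mono)
      fix a
      let ?S = "{b. \<bar>A1 * (a + h1)\<^sup>2 + A2 * (b + h2)\<^sup>2 + c'\<bar> \<le> \<eta>}"
      have S: "?S \<in> sets borel" by measurable
      have "(\<integral>\<^sup>+b. indicator (planar_sublevel A1 B1 \<zeta>1 A2 B2 \<zeta>2 c \<eta>) (a, b) \<partial>lborel)
        \<le> (\<integral>\<^sup>+b. indicator ?S b * indicator {0..1} a \<partial>lborel)"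
        by (intro nn_integral_mono) (auto simp: planar_sublevel_def eq split: split_indicator)
      also have "\<dots> = emeasure lborel ?S * indicator {0..1} a"
        using S by (simp add: nn_integral_multc)
      finally show "(\<integral>\<^sup>+b. indicator (planar_sublevel A1 B1 \<zeta>1 A2 B2 \<zeta>2 c \<eta>) (a, b) \<partial>lborel)
        \<le> emeasure lborel ?S * indicator {0..1} a" .
    qed
    also have "\<dots> \<le> ennreal (80 * \<eta> * ln (1 + 1 / sqrt \<eta>) / (sqrt \<bar>A1\<bar> * sqrt \<bar>A2\<bar>))"
      by (rule nn_integral_quadratic_sublevel[OF nz assms(1,6)])
    also have "\<dots> \<le> ennreal ?Z"
    proof (rule ennreal_leI)
      \<comment> \<open>The true factor is \<open>1 / (8 * 12) = 1 / 96\<close>; 100 is a perfect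
        square and turns the constant 80 into 8000.\<close>
      have "t1 / 100 \<le> \<bar>A1\<bar>" "t2 / 100 \<le> \<bar>A2\<bar>" using 3 assms by linarith+
      then have "sqrt (t1 / 100) * sqrt (t2 / 100) \<le> sqrt \<bar>A1\<bar> * sqrt \<bar>A2\<bar>"
        using assms by (intro mult_mono real_sqrt_le_mono) auto
      moreover have "sqrt 100 = (10::real)" using real_sqrt_abs[of 10] by simp
      ultimately have le: "sqrt t1 * sqrt t2 / 100 \<le> sqrt \<bar>A1\<bar> * sqrt \<bar>A2\<bar>"
        by (simp add: real_sqrt_divide)
      have "80 * \<eta> * ln (1 + 1 / sqrt \<eta>) / (sqrt \<bar>A1\<bar> * sqrt \<bar>A2\<bar>)
        \<le> 80 * \<eta> * ln (1 + 1 / sqrt \<eta>) / (sqrt t1 * sqrt t2 / 100)"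
        using assms nz by (intro divide_left_mono le) auto
      then show "80 * \<eta> * ln (1 + 1 / sqrt \<eta>) / (sqrt \<bar>A1\<bar> * sqrt \<bar>A2\<bar>) \<le> ?Z"
        by simp
    qed
    also have "\<dots> \<le> ennreal (?X + ?Y + ?Z)" using nonneg by (intro ennreal_leI) linarith
    finally show ?thesis .
  qed
qed

section \<open>Intersections of annuli\<close>

text \<open>The threshold is an equal share of the lower bound \<open>1 - \<delta>\<close> for the
  sum in \<open>ellipsoid_fun\<close>, so the pieces cover the annulus as \<open>i\<close> varies.
  On a piece the derivative along axis \<open>i\<close> is bounded away from 0 as long as
  \<open>\<delta>\<close> stays away from 1.\<close>

definition annulus_piece :: "'n::finite \<Rightarrow> real \<Rightarrow> real ^ 'n \<Rightarrow> real ^ 'n \<Rightarrow> (real ^ 'n) set" where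
  "annulus_piece i \<delta> x r = {y \<in> ellipsoidal_annulus \<delta> x r. (1 - \<delta>) / CARD('n) \<le> (y $ i - x $ i)\<^sup>2 / (r $ i)\<^sup>2}"

lemma inverse_square_radius_bounds:
  fixes \<rho> :: real
  assumes "\<rho> \<in> {1..2}"
  shows "1 / 4 \<le> 1 / \<rho>\<^sup>2" "1 / \<rho>\<^sup>2 \<le> 1"
proof -
  have "1\<^sup>2 \<le> \<rho>\<^sup>2" using assms by (intro power_mono) auto
  moreover have "\<rho>\<^sup>2 \<le> 2\<^sup>2" using assms by (intro power_mono) auto
  moreover have "0 < \<rho>\<^sup>2" using assms by simp
  ultimately show "1 / 4 \<le> 1 / \<rho>\<^sup>2" "1 / \<rho>\<^sup>2 \<le> 1" by (simp_all add: divide_simps)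
qed

lemma ellipsoidal_annulus_coordinate_le:
  fixes x y r :: "real ^ 'n::finite"
  assumes "y \<in> ellipsoidal_annulus \<delta> x r" "\<delta> \<le> 1" "\<forall>l. r $ l \<in> {1..2}"
  shows "\<bar>y $ l - x $ l\<bar> \<le> 3"
proof -
  have "(y $ l - x $ l)\<^sup>2 / (r $ l)\<^sup>2 \<le> (\<Sum>l\<in>UNIV. (y $ l - x $ l)\<^sup>2 / (r $ l)\<^sup>2)"
    by (intro member_le_sum) auto
  also have "\<dots> \<le> 2"
    using assms(1,2) by (auto simp: ellipsoidal_annulus_def ellipsoid_fun_def)
  finally have "(y $ l - x $ l)\<^sup>2 * (1 / (r $ l)\<^sup>2) \<le> 2" by simp
  moreover have "(y $ l - x $ l)\<^sup>2 * (1 / 4) \<le> (y $ l - x $ l)\<^sup>2 * (1 / (r $ l)\<^sup>2)"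
    by (intro mult_left_mono inverse_square_radius_bounds(1) assms(3)[rule_format]) auto
  ultimately have "(y $ l - x $ l)\<^sup>2 \<le> 3\<^sup>2" unfolding power2_eq_square by linarith
  then have "\<bar>y $ l - x $ l\<bar> \<le> \<bar>3\<bar>" by (simp only: abs_le_square_iff)
  then show ?thesis by simp
qed

lemma ellipsoidal_annulus_subset_cball:
  fixes x r :: "real ^ 'n::finite"
  assumes "\<delta> \<le> 1" "\<forall>l. r $ l \<in> {1..2}"
  shows "ellipsoidal_annulus \<delta> x r \<subseteq> cball x (3 * CARD('n))"
proof
  fix y assume y: "y \<in> ellipsoidal_annulus \<delta> x r"
  have "norm (y - x) \<le> (\<Sum>l\<in>UNIV. \<bar>(y - x) $ l\<bar>)" by (rule norm_le_l1_cart)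
  also have "\<dots> \<le> (\<Sum>l\<in>(UNIV::'n set). 3)"
    using ellipsoidal_annulus_coordinate_le[OF y assms] by (intro sum_mono) auto
  finally show "y \<in> cball x (3 * CARD('n))" by (simp add: dist_norm norm_minus_commute)
qed

section \<open>Averaging over translates\<close>

lemma nn_integral_lborel_translate:
  fixes \<phi> :: "'a::euclidean_space \<Rightarrow> ennreal"
  assumes [measurable]: "\<phi> \<in> borel_measurable borel"
  shows "(\<integral>\<^sup>+y. \<phi> (y + v) \<partial>lborel) = (\<integral>\<^sup>+y. \<phi> y \<partial>lborel)"
proof -
  have "(\<integral>\<^sup>+y. \<phi> y \<partial>lborel) = (\<integral>\<^sup>+y. \<phi> y \<partial>distr lborel borel ((+) v))"
    by (simp add: lborel_distr_plus)
  also have "\<dots> = (\<integral>\<^sup>+y. \<phi> (v + y) \<partial>lborel)"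
    by (rule nn_integral_distr) auto
  finally show ?thesis by (simp add: add.commute)
qed

text \<open>Averaging over translates reduces estimates on \<open>real ^ 'n\<close> to iterated one-dimensional ones along
  chosen axes, without splitting the type \<open>real ^ 'n\<close> into a product.\<close>

lemma nn_integral_shift_average:
  fixes \<phi> :: "'a::euclidean_space \<Rightarrow> ennreal"
  assumes [measurable]: "\<phi> \<in> borel_measurable borel"
  shows "(\<integral>\<^sup>+y. (\<integral>\<^sup>+a\<in>{0..1::real}. \<phi> (y + a *\<^sub>R v) \<partial>lborel) \<partial>lborel) = (\<integral>\<^sup>+y. \<phi> y \<partial>lborel)"
proof -
  have "(\<integral>\<^sup>+y. (\<integral>\<^sup>+a\<in>{0..1::real}. \<phi> (y + a *\<^sub>R v) \<partial>lborel) \<partial>lborel)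
     = (\<integral>\<^sup>+a. (\<integral>\<^sup>+y. \<phi> (y + a *\<^sub>R v) * indicator {0..1::real} a \<partial>lborel) \<partial>lborel)"
    by (rule lborel_pair.Fubini') measurable
  also have "\<dots> = (\<integral>\<^sup>+a. (\<integral>\<^sup>+y. \<phi> y \<partial>lborel) * indicator {0..1::real} a \<partial>lborel)"
    by (simp add: nn_integral_multc nn_integral_lborel_translate)
  also have "\<dots> = (\<integral>\<^sup>+y. \<phi> y \<partial>lborel)"
    by (simp add: nn_integral_cmult)
  finally show ?thesis .
qed

lemma nn_integral_shift_average2:
  fixes \<phi> :: "'a::euclidean_space \<Rightarrow> ennreal"
  assumes [measurable]: "\<phi> \<in> borel_measurable borel"
  shows "(\<integral>\<^sup>+y. (\<integral>\<^sup>+a\<in>{0..1::real}. (\<integral>\<^sup>+b\<in>{0..1::real}. \<phi> (y + a *\<^sub>R u + b *\<^sub>R v) \<partial>lborel) \<partial>lborel) \<partial>lborel)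
    = (\<integral>\<^sup>+y. \<phi> y \<partial>lborel)"
  using nn_integral_shift_average[of "\<lambda>y. (\<integral>\<^sup>+b\<in>{0..1::real}. \<phi> (y + b *\<^sub>R v) \<partial>lborel)" u]
    nn_integral_shift_average[of \<phi> v] by simp

lemma nn_integral_shift_average3:
  fixes \<phi> :: "'a::euclidean_space \<Rightarrow> ennreal"
  assumes [measurable]: "\<phi> \<in> borel_measurable borel"
  shows "(\<integral>\<^sup>+y. (\<integral>\<^sup>+a\<in>{0..1::real}. (\<integral>\<^sup>+b\<in>{0..1::real}. (\<integral>\<^sup>+c\<in>{0..1::real}.
      \<phi> (y + a *\<^sub>R u + b *\<^sub>R v + c *\<^sub>R w) \<partial>lborel) \<partial>lborel) \<partial>lborel) \<partial>lborel) = (\<integral>\<^sup>+y. \<phi> y \<partial>lborel)"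
  using nn_integral_shift_average2[of "\<lambda>y. (\<integral>\<^sup>+c\<in>{0..1::real}. \<phi> (y + c *\<^sub>R w) \<partial>lborel)" u v]
    nn_integral_shift_average[of \<phi> w] by simp

section \<open>Line sections and pairwise intersections of pieces\<close>

lemma annulus_piece_measurable [measurable]: "annulus_piece i \<delta> x r \<in> sets borel"
  unfolding annulus_piece_def ellipsoidal_annulus_def ellipsoid_fun_def by simp

lemma sum_UNIV_remove3:
  fixes f :: "'n::finite \<Rightarrow> 'a::comm_monoid_add"
  assumes "i \<noteq> j" "i \<noteq> k" "j \<noteq> k"
  shows "sum f UNIV = f i + (f j + (f k + sum f (UNIV - {i, j, k})))"
proof -
  have "UNIV = insert i (insert j (insert k (UNIV - {i, j, k})))" by auto
  then have "sum f UNIV = sum f (insert i (insert j (insert k (UNIV - {i, j, k}))))" by simp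
  also have "\<dots> = f i + (f j + (f k + sum f (UNIV - {i, j, k})))"
    using assms by (subst sum.insert; simp)+
  finally show ?thesis .
qed

text \<open>Along axis \<open>i\<close> the defining function is \<open>s * (c + h)^2\<close> plus a
  constant, and the piece keeps \<open>c + h\<close> away from 0. The line therefore crosses the
  piece transversally, in length of order \<open>\<delta>\<close> on each side of the vertex. For
  \<open>\<delta> > 1 / 2\<close> the length of the unit interval suffices.\<close>

lemma emeasure_annulus_piece_section:
  fixes \<delta> :: real and x y r :: "real ^ 'n::finite"
  assumes "0 < \<delta>" "\<delta> < 1" "\<forall>l. r $ l \<in> {1..2}"
  shows "(\<integral>\<^sup>+c\<in>{0..1}. indicator (annulus_piece i \<delta> x r) (y + c *\<^sub>R axis i 1) \<partial>lborel)
    \<le> ennreal (32 * CARD('n) * \<delta>)"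
proof -
  define S where "S = {c \<in> {0..1}. y + c *\<^sub>R axis i 1 \<in> annulus_piece i \<delta> x r}"
  have S: "S \<in> sets borel" unfolding S_def by simp
  have n: "1 \<le> real CARD('n)" by (simp add: Suc_leI)
  have "(\<integral>\<^sup>+c\<in>{0..1}. indicator (annulus_piece i \<delta> x r) (y + c *\<^sub>R axis i 1) \<partial>lborel) = (\<integral>\<^sup>+c. indicator S c \<partial>lborel)"
    by (intro nn_integral_cong) (auto simp: S_def split: split_indicator)
  also have "\<dots> = emeasure lborel S" using S by simp
  also have "\<dots> \<le> ennreal (32 * CARD('n) * \<delta>)"
  proof (cases "\<delta> \<le> 1 / 2")
    case False
    have "emeasure lborel S \<le> emeasure lborel {0..1::real}"
      by (intro emeasure_mono) (auto simp: S_def)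
    also have "\<dots> = ennreal 1" by simp
    also have "\<dots> \<le> ennreal (32 * CARD('n) * \<delta>)"
      using False n mult_mono[of 1 "real CARD('n)" "1/2" \<delta>] by (intro ennreal_leI) auto
    finally show ?thesis .
  next
    case True
    define h where "h = y $ i - x $ i"
    define s where "s = 1 / (r $ i)\<^sup>2"
    \<comment> \<open>A lower bound for \<open>(c + h)^2\<close> on the piece, from
      \<open>1 - \<delta> \<ge> 1 / 2\<close> and a radius of at least 1.\<close>
    define \<kappa> where "\<kappa> = 1 / (2 * CARD('n))"
    have s: "1 / 4 \<le> s" "s \<le> 1"
      unfolding s_def by (intro inverse_square_radius_bounds assms(3)[rule_format])+
    define m where "m = (\<Sum>l\<in>UNIV - {i}. (y $ l - x $ l)\<^sup>2 / (r $ l)\<^sup>2)"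
    have F: "ellipsoid_fun x r (y + c *\<^sub>R axis i 1) = s * (c + h)\<^sup>2 + m - 1" for c
    proof -
      have "(\<Sum>l\<in>UNIV. ((y + c *\<^sub>R axis i 1) $ l - x $ l)\<^sup>2 / (r $ l)\<^sup>2)
        = ((y + c *\<^sub>R axis i 1) $ i - x $ i)\<^sup>2 / (r $ i)\<^sup>2
          + (\<Sum>l\<in>UNIV - {i}. ((y + c *\<^sub>R axis i 1) $ l - x $ l)\<^sup>2 / (r $ l)\<^sup>2)"
        by (rule sum.remove) auto
      also have "(\<Sum>l\<in>UNIV - {i}. ((y + c *\<^sub>R axis i 1) $ l - x $ l)\<^sup>2 / (r $ l)\<^sup>2) = m"
        unfolding m_def by (intro sum.cong) (auto simp: axis_def)
      also have "((y + c *\<^sub>R axis i 1) $ i - x $ i)\<^sup>2 / (r $ i)\<^sup>2 = s * (c + h)\<^sup>2"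
        by (simp add: s_def h_def axis_def algebra_simps)
      finally show ?thesis by (simp add: ellipsoid_fun_def)
    qed
    have memS: "\<bar>s * (c + h)\<^sup>2 + m - 1\<bar> < \<delta>" "\<kappa> \<le> (c + h)\<^sup>2" if "c \<in> S" for c
    proof -
      show "\<bar>s * (c + h)\<^sup>2 + m - 1\<bar> < \<delta>"
        using that by (auto simp: S_def annulus_piece_def ellipsoidal_annulus_def F)
      have "\<kappa> \<le> (1 - \<delta>) / CARD('n)"
        using True n by (simp add: \<kappa>_def field_simps)
      also have "\<dots> \<le> s * (c + h)\<^sup>2"
        using that by (auto simp: S_def annulus_piece_def s_def h_def axis_def algebra_simps)
      also have "\<dots> \<le> 1 * (c + h)\<^sup>2" using s by (intro mult_right_mono) auto
      finally show "\<kappa> \<le> (c + h)\<^sup>2" by simp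
    qed
    have \<kappa>: "0 < \<kappa>" using n by (simp add: \<kappa>_def)
    have close: "\<bar>u - v\<bar> \<le> 8 * CARD('n) * \<delta>" if uv: "u \<in> S" "v \<in> S" and same: "0 \<le> (u + h) * (v + h)" for u v
    proof -
      have "s * \<bar>(u + h)\<^sup>2 - (v + h)\<^sup>2\<bar> = \<bar>s * (u + h)\<^sup>2 - s * (v + h)\<^sup>2\<bar>"
        using s by (simp add: abs_mult flip: right_diff_distrib)
      also have "\<dots> \<le> 2 * \<delta>"
        using memS(1)[OF uv(1)] memS(1)[OF uv(2)] by linarith
      finally have "s * \<bar>(u + h)\<^sup>2 - (v + h)\<^sup>2\<bar> \<le> 2 * \<delta>" .
      moreover have "1 / 4 * \<bar>(u + h)\<^sup>2 - (v + h)\<^sup>2\<bar> \<le> s * \<bar>(u + h)\<^sup>2 - (v + h)\<^sup>2\<bar>"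
        using s by (intro mult_right_mono) auto
      ultimately have 1: "\<bar>(u + h)\<^sup>2 - (v + h)\<^sup>2\<bar> \<le> 8 * \<delta>" by simp
      \<comment> \<open>Weakening to the square of \<open>1 / CARD('n)\<close> yields a lower bound
        for \<open>\<bar>(u + h) + (v + h)\<bar>\<close> without a root. The sign assumption drops
        the cross term.\<close>
      have "1 / (real CARD('n))\<^sup>2 \<le> 1 / real CARD('n)"
        using n by (simp add: field_simps power2_eq_square)
      also have "\<dots> = 2 * \<kappa>" by (simp add: \<kappa>_def)
      also have "\<dots> \<le> (u + h)\<^sup>2 + (v + h)\<^sup>2" using memS(2)[OF uv(1)] memS(2)[OF uv(2)] by linarith
      also have "\<dots> \<le> ((u + h) + (v + h))\<^sup>2" using same unfolding power2_sum[of "u + h" "v + h"] by linarith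
      finally have "(1 / real CARD('n))\<^sup>2 \<le> ((u + h) + (v + h))\<^sup>2" by (simp add: power_one_over)
      then have 2: "1 / real CARD('n) \<le> \<bar>(u + h) + (v + h)\<bar>"
        by (metis abs_le_square_iff abs_of_nonneg zero_le_divide_1_iff of_nat_0_le_iff)
      have "\<bar>u - v\<bar> * (1 / real CARD('n)) \<le> \<bar>u - v\<bar> * \<bar>(u + h) + (v + h)\<bar>"
        using 2 by (intro mult_left_mono) auto
      also have "\<dots> = \<bar>(u + h)\<^sup>2 - (v + h)\<^sup>2\<bar>"
        by (simp add: algebra_simps power2_eq_square flip: abs_mult)
      also note 1
      finally show ?thesis using n by (simp add: field_simps)
    qed
    have "emeasure lborel S \<le> ennreal (4 * (8 * CARD('n) * \<delta>))"
      using assms(1) by (intro emeasure_le_of_dist_le_sides[where h = h] close S) (auto simp: zero_le_mult_iff)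
    then show ?thesis by (simp add: mult.assoc)
  qed
  finally show ?thesis .
qed

text \<open>In the proof, \<open>s' i * F - s i * F'\<close> is the combination of the two defining functions that is
  free of the \<open>i\<close>-th coordinate; it is at most \<open>2 * \<delta>\<close> in absolute value on the intersection.\<close>

lemma emeasure_annulus_piece_inter:
  fixes \<delta> :: real and x r r' :: "real ^ 'n::finite"
  assumes ijk: "i \<noteq> j" "i \<noteq> k" "j \<noteq> k"
    and \<delta>: "0 < \<delta>" "\<delta> < 1"
    and r: "\<forall>l. r $ l \<in> {1..2}" and r': "\<forall>l. r' $ l \<in> {1..2}"
    and d: "d1 \<noteq> 0" "d2 \<noteq> 0"
    and K: "cball x (3 * CARD('n) + 3) \<subseteq> K" "K \<in> sets borel"
  defines "x' \<equiv> x + d1 *\<^sub>R axis j 1 + d2 *\<^sub>R axis k 1"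
    and "\<eta> \<equiv> 2 * \<delta>"
  shows "emeasure lborel (annulus_piece i \<delta> x r \<inter> annulus_piece i \<delta> x' r')
    \<le> emeasure lborel K * (ennreal (32 * CARD('n) * \<delta>)
        * ennreal (128 * \<eta> / (\<bar>d1\<bar> + \<eta>) + 128 * \<eta> / (\<bar>d2\<bar> + \<eta>)
        + 8000 * \<eta> * ln (1 + 1 / sqrt \<eta>) / (sqrt \<bar>d1\<bar> * sqrt \<bar>d2\<bar>)))"
    (is "_ \<le> emeasure lborel K * (?X * ?Y)")
proof -
  define S where "S = annulus_piece i \<delta> x r \<inter> annulus_piece i \<delta> x' r'"
  have S [measurable]: "S \<in> sets borel" unfolding S_def by simp
  define s where "s l = 1 / (r $ l)\<^sup>2" for l
  define s' where "s' l = 1 / (r' $ l)\<^sup>2" for l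
  have s: "1 / 4 \<le> s l" "s l \<le> 1" for l
    unfolding s_def by (intro inverse_square_radius_bounds r[rule_format])+
  have s': "1 / 4 \<le> s' l" "s' l \<le> 1" for l
    unfolding s'_def by (intro inverse_square_radius_bounds r'[rule_format])+
  \<comment> \<open>With \<open>z\<close> the offset from \<open>x\<close> in coordinate
    \<open>l\<close> and \<open>d\<close> the shift of the centre, that coordinate contributes
    \<open>s' i * s l * z^2 - s i * s' l * (z - d)^2\<close> to the combination. Its coefficients
    are \<open>A l\<close> and \<open>B l d\<close>, and the constant term goes into
    \<open>c0\<close>. In particular \<open>A i = 0\<close>.\<close>
  define A where "A l = s' i * s l - s i * s' l" for l
  define B where "B l d = 2 * (s i * s' l) * d" for l d
  have A: "\<bar>A l\<bar> \<le> 1" for l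
  proof -
    have "0 \<le> s l" "0 \<le> s' l" for l using s(1)[of l] s'(1)[of l] by linarith+
    then have "0 \<le> s' i * s l" "s' i * s l \<le> 1" "0 \<le> s i * s' l" "s i * s' l \<le> 1"
      using s s' by (auto intro: mult_le_one)
    then show ?thesis unfolding A_def by linarith
  qed
  \<comment> \<open>The linear coefficient is a product, not a difference: for any two radii no
    cancellation can occur, whereas \<open>A l\<close> may vanish.\<close>
  have B: "\<bar>d\<bar> / 8 \<le> \<bar>B l d\<bar>" for l d
  proof -
    have "1 / 4 * (1 / 4) \<le> s i * s' l"
      using s(1)[of i] s'(1)[of l] by (intro mult_mono) auto
    then have "1 / 16 * \<bar>d\<bar> \<le> (s i * s' l) * \<bar>d\<bar>" by (intro mult_right_mono) auto
    moreover have "\<bar>B l d\<bar> = 2 * ((s i * s' l) * \<bar>d\<bar>)"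
      using s(1)[of i] s'(1)[of l] by (simp add: B_def abs_mult)
    ultimately show ?thesis by linarith
  qed
  define c0 where "c0 y = - s i * s' j * d1\<^sup>2 - s i * s' k * d2\<^sup>2
      + (\<Sum>l\<in>UNIV - {i, j, k}. A l * (y $ l - x $ l)\<^sup>2) - (s' i - s i)" for y :: "real ^ 'n"
  define P where "P y = planar_sublevel (A j) (B j d1) (y $ j - x $ j) (A k) (B k d2) (y $ k - x $ k) (c0 y) \<eta>"
    for y :: "real ^ 'n"
  have planar: "(a, b) \<in> P y"
    if mem: "y + a *\<^sub>R axis j 1 + b *\<^sub>R axis k 1 + c *\<^sub>R axis i 1 \<in> S" and ab: "a \<in> {0..1}" "b \<in> {0..1}"
    for y a b c
  proof -
    define Y where "Y = y + a *\<^sub>R axis j 1 + b *\<^sub>R axis k 1 + c *\<^sub>R axis i 1"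
    have Yl: "Y $ l = y $ l" if "l \<notin> {i, j, k}" for l
      using that by (auto simp: Y_def axis_def)
    have Yj: "Y $ j = y $ j + a" "Y $ k = y $ k + b"
      using ijk by (auto simp: Y_def axis_def)
    have x'l: "x' $ l = x $ l" if "l \<noteq> j" "l \<noteq> k" for l
      using that by (auto simp: x'_def axis_def)
    have x'j: "x' $ j = x $ j + d1" "x' $ k = x $ k + d2"
      using ijk by (auto simp: x'_def axis_def)
    have Y: "Y \<in> ellipsoidal_annulus \<delta> x r" "Y \<in> ellipsoidal_annulus \<delta> x' r'"
      using mem by (auto simp: S_def annulus_piece_def Y_def)
    have F: "\<bar>ellipsoid_fun x r Y\<bar> < \<delta>" "\<bar>ellipsoid_fun x' r' Y\<bar> < \<delta>"
      using Y by (auto simp: ellipsoidal_annulus_def)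
    have "s' i * ellipsoid_fun x r Y - s i * ellipsoid_fun x' r' Y
      = (\<Sum>l\<in>UNIV. s' i * (s l * (Y $ l - x $ l)\<^sup>2) - s i * (s' l * (Y $ l - x' $ l)\<^sup>2)) - (s' i - s i)"
      by (simp add: ellipsoid_fun_def s_def s'_def sum_subtractf sum_distrib_left algebra_simps)
    also have "(\<Sum>l\<in>UNIV. s' i * (s l * (Y $ l - x $ l)\<^sup>2) - s i * (s' l * (Y $ l - x' $ l)\<^sup>2))
      = (s' i * (s j * (y $ j - x $ j + a)\<^sup>2) - s i * (s' j * (y $ j - x $ j + a - d1)\<^sup>2))
      + ((s' i * (s k * (y $ k - x $ k + b)\<^sup>2) - s i * (s' k * (y $ k - x $ k + b - d2)\<^sup>2))
      + (\<Sum>l\<in>UNIV - {i, j, k}. A l * (y $ l - x $ l)\<^sup>2))"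
    proof -
      have "(\<Sum>l\<in>UNIV - {i, j, k}. s' i * (s l * (Y $ l - x $ l)\<^sup>2) - s i * (s' l * (Y $ l - x' $ l)\<^sup>2))
        = (\<Sum>l\<in>UNIV - {i, j, k}. A l * (y $ l - x $ l)\<^sup>2)"
        by (intro sum.cong) (auto simp: Yl x'l A_def algebra_simps)
      then show ?thesis
        using ijk by (simp add: sum_UNIV_remove3[OF ijk] Yj x'j x'l algebra_simps)
    qed
    finally have H: "s' i * ellipsoid_fun x r Y - s i * ellipsoid_fun x' r' Y
      = A j * (y $ j - x $ j + a)\<^sup>2 + B j d1 * (y $ j - x $ j + a)
        + (A k * (y $ k - x $ k + b)\<^sup>2 + B k d2 * (y $ k - x $ k + b)) + c0 y"
      by (simp add: A_def B_def c0_def power2_eq_square algebra_simps)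
    have "\<bar>s' i * ellipsoid_fun x r Y\<bar> \<le> 1 * \<delta>" "\<bar>s i * ellipsoid_fun x' r' Y\<bar> \<le> 1 * \<delta>"
      unfolding abs_mult using s(1)[of i] s'(1)[of i] s(2)[of i] s'(2)[of i] F by (intro mult_mono; simp)+
    then have "\<bar>s' i * ellipsoid_fun x r Y - s i * ellipsoid_fun x' r' Y\<bar> \<le> \<eta>"
      unfolding \<eta>_def by linarith
    moreover have "\<bar>y $ j - x $ j + a\<bar> \<le> 3" "\<bar>y $ k - x $ k + b\<bar> \<le> 3"
      using ellipsoidal_annulus_coordinate_le[OF Y(1) _ r, of j] ellipsoidal_annulus_coordinate_le[OF Y(1) _ r, of k] \<delta>
      by (auto simp: Yj algebra_simps)
    ultimately show ?thesis
      using ab unfolding P_def planar_sublevel_def H by simp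
  qed
  \<comment> \<open>The three unit displacements move a point by at most 3, which explains the
    enlarged radius of the ball inside \<open>K\<close>.\<close>
  have inK: "y \<in> K"
    if mem: "y + a *\<^sub>R axis j 1 + b *\<^sub>R axis k 1 + c *\<^sub>R axis i 1 \<in> S" and abc: "a \<in> {0..1}" "b \<in> {0..1}" "c \<in> {0..1}"
    for y a b c
  proof -
    define v where "v = a *\<^sub>R axis j 1 + b *\<^sub>R axis k 1 + (c *\<^sub>R axis i 1 :: real ^ 'n)"
    have "y + v \<in> cball x (3 * CARD('n))"
      using mem ellipsoidal_annulus_subset_cball[OF less_imp_le[OF \<delta>(2)] r, of x]
      by (auto simp: S_def annulus_piece_def v_def add.assoc)
    moreover have "norm v \<le> 1 + 1 + 1"
      unfolding v_def using abc by (intro norm_triangle_mono) auto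
    ultimately have "y \<in> cball x (3 * CARD('n) + 3)"
      using norm_triangle_ineq4[of "x - (y + v)" "- v"] by (auto simp: dist_norm algebra_simps)
    then show ?thesis using K(1) by auto
  qed
  let ?\<phi> = "\<lambda>y a b c. indicator S (y + a *\<^sub>R axis j 1 + b *\<^sub>R axis k 1 + c *\<^sub>R axis i 1) :: ennreal"
  \<comment> \<open>Membership of \<open>(a, b)\<close> in \<open>P y\<close> does not involve
    \<open>c\<close>. The integral over \<open>c\<close> thus supplies one factor of order
    \<open>\<delta>\<close> from the transversal section, and the planar set independently supplies
    the other.\<close>
  have c_int: "(\<integral>\<^sup>+c\<in>{0..1}. ?\<phi> y a b c \<partial>lborel) * indicator {0..1} b * indicator {0..1} a
      \<le> (indicator K y * ?X) * indicator (P y) (a, b)" for y a b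
  proof (cases "a \<in> {0..1} \<and> b \<in> {0..1} \<and> (\<exists>c\<in>{0..1}. y + a *\<^sub>R axis j 1 + b *\<^sub>R axis k 1 + c *\<^sub>R axis i 1 \<in> S)")
    case True
    then have "(a, b) \<in> P y" "y \<in> K" using planar inK by blast+
    moreover have "(\<integral>\<^sup>+c\<in>{0..1}. ?\<phi> y a b c \<partial>lborel)
      \<le> (\<integral>\<^sup>+c\<in>{0..1}. indicator (annulus_piece i \<delta> x r) ((y + a *\<^sub>R axis j 1 + b *\<^sub>R axis k 1) + c *\<^sub>R axis i 1) \<partial>lborel)"
      by (intro nn_integral_mono) (auto simp: S_def split: split_indicator)
    moreover have "\<dots> \<le> ?X"
      by (rule emeasure_annulus_piece_section[OF \<delta> r])
    ultimately show ?thesis using True by auto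
  next
    case False
    then have "indicator {0..1} a = (0::ennreal) \<or> indicator {0..1} b = (0::ennreal) \<or> (\<integral>\<^sup>+c\<in>{0..1}. ?\<phi> y a b c \<partial>lborel) = 0"
      by (auto simp: nn_integral_0_iff_AE split: split_indicator)
    then show ?thesis by auto
  qed
  have "emeasure lborel S = (\<integral>\<^sup>+y. indicator S y \<partial>lborel)" by simp
  also have "\<dots> = (\<integral>\<^sup>+y. (\<integral>\<^sup>+a\<in>{0..1::real}. (\<integral>\<^sup>+b\<in>{0..1::real}. (\<integral>\<^sup>+c\<in>{0..1::real}. ?\<phi> y a b c \<partial>lborel) \<partial>lborel) \<partial>lborel) \<partial>lborel)"
    by (rule nn_integral_shift_average3[symmetric]) simp
  also have "\<dots> = (\<integral>\<^sup>+y. (\<integral>\<^sup>+a. (\<integral>\<^sup>+b. (\<integral>\<^sup>+c\<in>{0..1::real}. ?\<phi> y a b c \<partial>lborel) * indicator {0..1} b * indicator {0..1} a \<partial>lborel) \<partial>lborel) \<partial>lborel)"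
    by (simp add: nn_integral_multc)
  also have "\<dots> \<le> (\<integral>\<^sup>+y. (\<integral>\<^sup>+a. (\<integral>\<^sup>+b. (indicator K y * ?X) * indicator (P y) (a, b) \<partial>lborel) \<partial>lborel) \<partial>lborel)"
    by (intro nn_integral_mono c_int)
  also have "\<dots> = (\<integral>\<^sup>+y. (indicator K y * ?X) * (\<integral>\<^sup>+a. (\<integral>\<^sup>+b. indicator (P y) (a, b) \<partial>lborel) \<partial>lborel) \<partial>lborel)"
    unfolding P_def by (simp add: nn_integral_cmult)
  also have "\<dots> \<le> (\<integral>\<^sup>+y. (indicator K y * ?X) * ?Y \<partial>lborel)"
    unfolding P_def using d \<delta> A B
    by (intro nn_integral_mono mult_left_mono nn_integral_planar_sublevel) (auto simp: \<eta>_def)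
  also have "\<dots> = emeasure lborel K * (?X * ?Y)"
    using K(2) by (simp add: mult.assoc nn_integral_multc)
  finally show ?thesis unfolding S_def .
qed

section \<open>Schur test and averaging\<close>

lemma ennreal_two_mult_le_squares:
  fixes a b :: ennreal
  shows "2 * (a * b) \<le> a\<^sup>2 + b\<^sup>2"
proof (cases a; cases b)
  fix p q :: real assume pq: "0 \<le> p" "a = ennreal p" "0 \<le> q" "b = ennreal q"
  have "2 * (p * q) \<le> p\<^sup>2 + q\<^sup>2" using sum_squares_bound[of p q] by simp
  then have "ennreal (2 * (p * q)) \<le> ennreal (p\<^sup>2 + q\<^sup>2)" by (rule ennreal_leI)
  then show ?thesis using pq by (simp add: ennreal_mult ennreal_power)
qed (auto simp: power2_eq_square)

text \<open>Let \<open>u\<close> be the operator applied to \<open>h\<close> and \<open>v\<close>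
  the adjoint applied to \<open>u\<close>. The composed kernel in \<open>(p, q)\<close> is
  symmetric, so the row bound \<open>B\<close> alone controls the integral of \<open>v^2\<close> by
  \<open>B * U\<close>. Since \<open>U\<close> is the pairing of \<open>v\<close> with
  \<open>h\<close>, a weighted arithmetic-geometric inequality closes the estimate without square
  roots in \<open>ennreal\<close>.\<close>

lemma nn_integral_square_le_of_schur:
  fixes \<psi> :: "'a \<Rightarrow> 'b \<Rightarrow> ennreal" and h :: "'b \<Rightarrow> ennreal" and B :: real
  assumes M: "sigma_finite_measure M" and N: "sigma_finite_measure N"
    and \<psi> [measurable]: "case_prod \<psi> \<in> borel_measurable (M \<Otimes>\<^sub>M N)"
    and h [measurable]: "h \<in> borel_measurable N"
    and kernel: "\<And>p. p \<in> space M \<Longrightarrow> (\<integral>\<^sup>+q. (\<integral>\<^sup>+y. \<psi> p y * \<psi> q y \<partial>N) \<partial>M) \<le> ennreal B"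
    and B: "0 < B"
  defines "u \<equiv> \<lambda>p. (\<integral>\<^sup>+y. \<psi> p y * h y \<partial>N)"
  assumes fin: "(\<integral>\<^sup>+p. (u p)\<^sup>2 \<partial>M) < \<infinity>"
  shows "(\<integral>\<^sup>+p. (u p)\<^sup>2 \<partial>M) \<le> ennreal B * (\<integral>\<^sup>+y. (h y)\<^sup>2 \<partial>N)"
proof -
  interpret M: sigma_finite_measure M by (rule M)
  interpret N: sigma_finite_measure N by (rule N)
  interpret MN: pair_sigma_finite M N ..
  interpret MM: pair_sigma_finite M M ..
  define U where "U = (\<integral>\<^sup>+p. (u p)\<^sup>2 \<partial>M)"
  define H where "H = (\<integral>\<^sup>+y. (h y)\<^sup>2 \<partial>N)"
  have u [measurable]: "u \<in> borel_measurable M" unfolding u_def by measurable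
  define v where "v y = (\<integral>\<^sup>+p. \<psi> p y * u p \<partial>M)" for y
  have v [measurable]: "v \<in> borel_measurable N" unfolding v_def by measurable
  have "U = (\<integral>\<^sup>+p. (\<integral>\<^sup>+y. u p * (\<psi> p y * h y) \<partial>N) \<partial>M)"
    unfolding U_def power2_eq_square by (subst (2) u_def) (auto intro!: nn_integral_cong simp: nn_integral_cmult)
  also have "\<dots> = (\<integral>\<^sup>+y. (\<integral>\<^sup>+p. u p * (\<psi> p y * h y) \<partial>M) \<partial>N)"
    by (rule MN.Fubini'[symmetric]) measurable
  also have "\<dots> = (\<integral>\<^sup>+y. (\<integral>\<^sup>+p. \<psi> p y * u p * h y \<partial>M) \<partial>N)"
    by (simp add: mult_ac)
  also have "\<dots> = (\<integral>\<^sup>+y. v y * h y \<partial>N)"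
    unfolding v_def by (auto intro!: nn_integral_cong simp: nn_integral_multc)
  finally have U: "U = (\<integral>\<^sup>+y. v y * h y \<partial>N)" .
  have "2 * (\<integral>\<^sup>+y. (v y)\<^sup>2 \<partial>N) \<le> 2 * (ennreal B * U)"
  proof -
    have "(\<integral>\<^sup>+y. (v y)\<^sup>2 \<partial>N) = (\<integral>\<^sup>+y. (\<integral>\<^sup>+p. (\<integral>\<^sup>+q. \<psi> p y * \<psi> q y * (u p * u q) \<partial>M) \<partial>M) \<partial>N)"
    proof (rule nn_integral_cong)
      fix y assume [simp]: "y \<in> space N"
      have "(v y)\<^sup>2 = (\<integral>\<^sup>+p. \<psi> p y * u p * v y \<partial>M)"
        unfolding power2_eq_square by (subst (1) v_def) (simp add: nn_integral_multc)
      also have "\<dots> = (\<integral>\<^sup>+p. (\<integral>\<^sup>+q. \<psi> p y * u p * (\<psi> q y * u q) \<partial>M) \<partial>M)"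
        unfolding v_def by (simp add: nn_integral_cmult)
      finally show "(v y)\<^sup>2 = (\<integral>\<^sup>+p. (\<integral>\<^sup>+q. \<psi> p y * \<psi> q y * (u p * u q) \<partial>M) \<partial>M)"
        by (simp add: mult_ac)
    qed
    then have "2 * (\<integral>\<^sup>+y. (v y)\<^sup>2 \<partial>N) = (\<integral>\<^sup>+y. (\<integral>\<^sup>+p. (\<integral>\<^sup>+q. \<psi> p y * \<psi> q y * (2 * (u p * u q)) \<partial>M) \<partial>M) \<partial>N)"
      by (simp add: mult.left_commute[of _ 2] nn_integral_cmult cong: nn_integral_cong_simp)
    \<comment> \<open>The two squares contribute equally, because exchanging \<open>p\<close> and
      \<open>q\<close> preserves the kernel.\<close>
    also have "\<dots> \<le> (\<integral>\<^sup>+y. (\<integral>\<^sup>+p. (\<integral>\<^sup>+q. \<psi> p y * \<psi> q y * ((u p)\<^sup>2 + (u q)\<^sup>2) \<partial>M) \<partial>M) \<partial>N)"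
      by (intro nn_integral_mono mult_left_mono ennreal_two_mult_le_squares) auto
    also have "\<dots> = (\<integral>\<^sup>+y. (\<integral>\<^sup>+p. (\<integral>\<^sup>+q. \<psi> p y * \<psi> q y * (u p)\<^sup>2 \<partial>M) \<partial>M)
        + (\<integral>\<^sup>+p. (\<integral>\<^sup>+q. \<psi> p y * \<psi> q y * (u q)\<^sup>2 \<partial>M) \<partial>M) \<partial>N)"
      by (simp add: distrib_left nn_integral_add cong: nn_integral_cong_simp)
    also have "\<dots> = (\<integral>\<^sup>+y. 2 * (\<integral>\<^sup>+p. (\<integral>\<^sup>+q. \<psi> p y * \<psi> q y * (u p)\<^sup>2 \<partial>M) \<partial>M) \<partial>N)"
    proof (rule nn_integral_cong)
      fix y assume [simp]: "y \<in> space N"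
      have "(\<integral>\<^sup>+p. (\<integral>\<^sup>+q. \<psi> p y * \<psi> q y * (u q)\<^sup>2 \<partial>M) \<partial>M) = (\<integral>\<^sup>+q. (\<integral>\<^sup>+p. \<psi> p y * \<psi> q y * (u q)\<^sup>2 \<partial>M) \<partial>M)"
        by (rule MM.Fubini'[symmetric]) measurable
      then show "(\<integral>\<^sup>+p. (\<integral>\<^sup>+q. \<psi> p y * \<psi> q y * (u p)\<^sup>2 \<partial>M) \<partial>M)
        + (\<integral>\<^sup>+p. (\<integral>\<^sup>+q. \<psi> p y * \<psi> q y * (u q)\<^sup>2 \<partial>M) \<partial>M)
        = 2 * (\<integral>\<^sup>+p. (\<integral>\<^sup>+q. \<psi> p y * \<psi> q y * (u p)\<^sup>2 \<partial>M) \<partial>M)"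
        by (simp add: mult_2 mult.commute)
    qed
    also have "\<dots> = 2 * (\<integral>\<^sup>+y. (\<integral>\<^sup>+p. (\<integral>\<^sup>+q. \<psi> p y * \<psi> q y * (u p)\<^sup>2 \<partial>M) \<partial>M) \<partial>N)"
      by (simp add: nn_integral_cmult)
    also have "(\<integral>\<^sup>+y. (\<integral>\<^sup>+p. (\<integral>\<^sup>+q. \<psi> p y * \<psi> q y * (u p)\<^sup>2 \<partial>M) \<partial>M) \<partial>N)
      = (\<integral>\<^sup>+p. (\<integral>\<^sup>+y. (\<integral>\<^sup>+q. \<psi> p y * \<psi> q y * (u p)\<^sup>2 \<partial>M) \<partial>N) \<partial>M)"
      by (rule MN.Fubini') measurable
    also have "\<dots> = (\<integral>\<^sup>+p. (\<integral>\<^sup>+q. (\<integral>\<^sup>+y. \<psi> p y * \<psi> q y * (u p)\<^sup>2 \<partial>N) \<partial>M) \<partial>M)"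
      by (intro nn_integral_cong MN.Fubini') measurable
    also have "\<dots> = (\<integral>\<^sup>+p. (\<integral>\<^sup>+q. (\<integral>\<^sup>+y. \<psi> p y * \<psi> q y \<partial>N) \<partial>M) * (u p)\<^sup>2 \<partial>M)"
      by (simp add: nn_integral_multc cong: nn_integral_cong_simp)
    also have "\<dots> \<le> (\<integral>\<^sup>+p. ennreal B * (u p)\<^sup>2 \<partial>M)"
      by (intro nn_integral_mono mult_right_mono kernel) auto
    also have "\<dots> = ennreal B * U" unfolding U_def by (simp add: nn_integral_cmult)
    finally show ?thesis by (simp add: mult_left_mono)
  qed
  then have V: "(\<integral>\<^sup>+y. (v y)\<^sup>2 \<partial>N) \<le> ennreal B * U"
    by (subst (asm) ennreal_mult_le_mult_iff) auto
  \<comment> \<open>The weight \<open>B\<close> on \<open>h\<close> is chosen so that the bound on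
    \<open>v\<close> consumes exactly one of the two copies of \<open>B * U\<close>.\<close>
  have "2 * (ennreal B * U) = (\<integral>\<^sup>+y. 2 * (v y * (ennreal B * h y)) \<partial>N)"
    unfolding U by (simp add: nn_integral_cmult mult.left_commute[of _ "ennreal B"])
  also have "\<dots> \<le> (\<integral>\<^sup>+y. (v y)\<^sup>2 + (ennreal B * h y)\<^sup>2 \<partial>N)"
    by (intro nn_integral_mono ennreal_two_mult_le_squares)
  also have "\<dots> = (\<integral>\<^sup>+y. (v y)\<^sup>2 \<partial>N) + (ennreal B)\<^sup>2 * H"
    unfolding H_def by (simp add: nn_integral_add nn_integral_cmult power_mult_distrib)
  also have "\<dots> \<le> ennreal B * U + ennreal B * (ennreal B * H)"
    using V by (simp add: power2_eq_square mult.assoc)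
  finally have "ennreal B * U + ennreal B * U \<le> ennreal B * U + ennreal B * (ennreal B * H)"
    by (simp add: mult_2)
  \<comment> \<open>Cancelling a summand in \<open>ennreal\<close> is valid only if it is finite;
    this is where \<open>fin\<close> enters.\<close>
  moreover have "ennreal B * U < \<infinity>" using fin by (simp add: U_def ennreal_mult_less_top)
  ultimately have "ennreal B * U \<le> ennreal B * (ennreal B * H)"
    by (auto simp: ennreal_add_left_cancel_le)
  then have "U \<le> ennreal B * H"
    using B by (subst (asm) ennreal_mult_le_mult_iff) auto
  then show ?thesis unfolding U_def H_def .
qed

section \<open>Measurable choice of the radii\<close>

text \<open>A measurable maximiser turns the supremum into a linear integral operator, to which the
  Schur test applies. It is built by comparing one new candidate at a time. Measurability of the
  attained value is carried through the induction, since measurability of \<open>\<sigma>\<close>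
  alone does not give it.\<close>

lemma measurable_argmax_exists:
  fixes U :: "'b::topological_space \<Rightarrow> 'a \<Rightarrow> ennreal"
  assumes "finite R" "R \<noteq> {}" "\<And>r. r \<in> R \<Longrightarrow> U r \<in> borel_measurable M"
  shows "\<exists>\<sigma>\<in>borel_measurable M. (\<forall>p. \<sigma> p \<in> R) \<and> (\<forall>p. \<forall>r\<in>R. U r p \<le> U (\<sigma> p) p)
    \<and> (\<lambda>p. U (\<sigma> p) p) \<in> borel_measurable M"
  using assms
proof (induction R rule: finite_ne_induct)
  case (singleton r)
  then show ?case by (intro bexI[of _ "\<lambda>_. r"]) auto
next
  case (insert r R)
  then obtain \<sigma> where \<sigma> [measurable]: "\<sigma> \<in> borel_measurable M" and
    *: "\<forall>p. \<sigma> p \<in> R" "\<forall>p. \<forall>r\<in>R. U r p \<le> U (\<sigma> p) p" and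
    [measurable]: "(\<lambda>p. U (\<sigma> p) p) \<in> borel_measurable M"
    by auto
  have [measurable]: "U r \<in> borel_measurable M" using insert by auto
  let ?\<sigma> = "\<lambda>p. if U (\<sigma> p) p \<le> U r p then r else \<sigma> p"
  have "(\<lambda>p. if U (\<sigma> p) p \<le> U r p then U r p else U (\<sigma> p) p) \<in> borel_measurable M" by measurable
  also have "(\<lambda>p. if U (\<sigma> p) p \<le> U r p then U r p else U (\<sigma> p) p) = (\<lambda>p. U (?\<sigma> p) p)" by auto
  finally have "(\<lambda>p. U (?\<sigma> p) p) \<in> borel_measurable M" .
  moreover have "?\<sigma> \<in> borel_measurable M" by measurable
  moreover have "\<forall>p. \<forall>r'\<in>insert r R. U r' p \<le> U (?\<sigma> p) p"
    using *(2) by (auto intro: order_trans)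
  ultimately show ?case using *(1) by (intro bexI[of _ ?\<sigma>]) auto
qed

lemma indicator_annulus_piece_measurable [measurable (raw)]:
  fixes f g \<rho> :: "'a \<Rightarrow> real ^ 'n::finite"
  assumes [measurable]: "f \<in> borel_measurable M" "g \<in> borel_measurable M" "\<rho> \<in> borel_measurable M"
  shows "(\<lambda>p. indicator (annulus_piece i \<delta> (f p) (\<rho> p)) (g p) :: ennreal) \<in> borel_measurable M"
proof -
  have [measurable]: "(\<lambda>p. f p $ l) \<in> borel_measurable M" if "f \<in> borel_measurable M" for f :: "'a \<Rightarrow> real ^ 'n" and l
    using that by (rule measurable_compose) (intro borel_measurable_continuous_onI continuous_intros)
  have "(\<lambda>p. indicator (annulus_piece i \<delta> (f p) (\<rho> p)) (g p) :: ennreal)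
    = (\<lambda>p. if \<bar>(\<Sum>j\<in>UNIV. (g p $ j - f p $ j)\<^sup>2 / (\<rho> p $ j)\<^sup>2) - 1\<bar> < \<delta>
        \<and> (1 - \<delta>) / CARD('n) \<le> (g p $ i - f p $ i)\<^sup>2 / (\<rho> p $ i)\<^sup>2 then 1 else 0)"
    by (auto simp: annulus_piece_def ellipsoidal_annulus_def ellipsoid_fun_def indicator_def)
  then show ?thesis by simp
qed

section \<open>Integral of the intersection kernel over a unit square\<close>

text \<open>The mixed term is a product of two integrable inverse square roots, so it loses only the
  logarithm it already carries; the other two terms acquire theirs by integration.\<close>

lemma nn_integral_kernel_bound:
  fixes \<delta> a b :: real
  assumes "0 < \<delta>" "\<delta> < 1"
  defines "\<eta> \<equiv> 2 * \<delta>"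
  shows "(\<integral>\<^sup>+a'\<in>{0..1}. (\<integral>\<^sup>+b'\<in>{0..1}. ennreal (128 * \<eta> / (\<bar>a' - a\<bar> + \<eta>) + 128 * \<eta> / (\<bar>b' - b\<bar> + \<eta>)
        + 8000 * \<eta> * ln (1 + 1 / sqrt \<eta>) / (sqrt \<bar>a' - a\<bar> * sqrt \<bar>b' - b\<bar>)) \<partial>lborel) \<partial>lborel)
    \<le> ennreal (260000 * \<delta> * ln (1 + 1 / \<delta>))"
proof -
  define \<Lambda> where "\<Lambda> = ln (1 + 1 / \<delta>)"
  define L where "L = ln (1 + 1 / sqrt \<eta>)"
  have \<eta>: "0 < \<eta>" using assms by simp
  \<comment> \<open>Since \<open>\<delta>\<close> is below both \<open>sqrt \<eta>\<close> and
    \<open>\<eta>\<close>, both logarithms are dominated by \<open>\<Lambda>\<close>.\<close>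
  have "\<delta> \<le> sqrt \<eta>"
    using assms mult_strict_right_mono[of \<delta> 1 \<delta>] by (intro real_le_rsqrt) (simp add: power2_eq_square \<eta>_def)
  then have "1 / sqrt \<eta> \<le> 1 / \<delta>" using assms by (intro divide_left_mono) auto
  then have L: "0 \<le> L" "L \<le> \<Lambda>"
    unfolding L_def \<Lambda>_def using \<eta> by (auto intro!: ln_mono add_pos_nonneg)
  have "1 / \<eta> \<le> 1 / \<delta>" using assms by (intro divide_left_mono) auto
  then have L': "0 \<le> ln (1 + 1 / \<eta>)" "ln (1 + 1 / \<eta>) \<le> \<Lambda>"
    unfolding \<Lambda>_def using \<eta> by (auto intro!: ln_mono add_pos_nonneg)
  define f where "f c a = ennreal (1 / (\<bar>a - c\<bar> + \<eta>))" for c a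
  define g where "g c a = ennreal (1 / sqrt \<bar>a - c\<bar>)" for c a
  have fg [measurable]: "f c \<in> borel_measurable borel" "g c \<in> borel_measurable borel" for c
    unfolding f_def g_def by measurable
  have f: "(\<integral>\<^sup>+a\<in>{0..1}. f c a \<partial>lborel) \<le> ennreal (2 * \<Lambda>)" for c
  proof -
    have "(\<integral>\<^sup>+a\<in>{0..1}. f c a \<partial>lborel) \<le> ennreal (2 * ln (1 + 1 / \<eta>))"
      unfolding f_def using \<eta> by (rule nn_integral_inverse_dist_le)
    also have "\<dots> \<le> ennreal (2 * \<Lambda>)" using L' by (intro ennreal_leI) simp
    finally show ?thesis .
  qed
  have g: "(\<integral>\<^sup>+a\<in>{0..1}. g c a \<partial>lborel) \<le> 4" for c
    unfolding g_def by (rule nn_integral_inverse_sqrt_dist_le)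
  \<comment> \<open>This also holds for \<open>a' = a\<close> or \<open>b' = b\<close>, where
    \<open>1 / 0 = 0\<close> makes both mixed terms vanish.\<close>
  have split: "ennreal (128 * \<eta> / (\<bar>a' - a\<bar> + \<eta>) + 128 * \<eta> / (\<bar>b' - b\<bar> + \<eta>)
        + 8000 * \<eta> * ln (1 + 1 / sqrt \<eta>) / (sqrt \<bar>a' - a\<bar> * sqrt \<bar>b' - b\<bar>))
     = ennreal (128 * \<eta>) * f a a' + ennreal (128 * \<eta>) * f b b' + ennreal (8000 * \<eta> * L) * (g a a' * g b b')" for a' b'
  proof -
    have "ennreal (128 * \<eta> / (\<bar>a' - a\<bar> + \<eta>)) = ennreal (128 * \<eta>) * f a a'"
      "ennreal (128 * \<eta> / (\<bar>b' - b\<bar> + \<eta>)) = ennreal (128 * \<eta>) * f b b'"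
      unfolding f_def using \<eta> by (simp_all flip: ennreal_mult)
    moreover have "ennreal (8000 * \<eta> * ln (1 + 1 / sqrt \<eta>) / (sqrt \<bar>a' - a\<bar> * sqrt \<bar>b' - b\<bar>))
      = ennreal (8000 * \<eta> * L) * (g a a' * g b b')"
      unfolding g_def L_def[symmetric] using \<eta> L by (simp flip: ennreal_mult)
    ultimately show ?thesis
      using \<eta> L unfolding L_def[symmetric] by (subst ennreal_plus; simp)+
  qed
  have I1: "(\<integral>\<^sup>+a. indicator {0..1::real} a \<partial>lborel) = (1::ennreal)" by simp
  have inner: "(\<integral>\<^sup>+b'\<in>{0..1}. ennreal (128 * \<eta> / (\<bar>a' - a\<bar> + \<eta>) + 128 * \<eta> / (\<bar>b' - b\<bar> + \<eta>)
        + 8000 * \<eta> * ln (1 + 1 / sqrt \<eta>) / (sqrt \<bar>a' - a\<bar> * sqrt \<bar>b' - b\<bar>)) \<partial>lborel)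
    = ennreal (128 * \<eta>) * f a a' + ennreal (128 * \<eta>) * (\<integral>\<^sup>+b'\<in>{0..1}. f b b' \<partial>lborel)
        + ennreal (8000 * \<eta> * L) * (g a a' * (\<integral>\<^sup>+b'\<in>{0..1}. g b b' \<partial>lborel))" for a'
    unfolding split
    by (simp add: distrib_right mult.assoc nn_integral_add nn_integral_cmult I1)
  have "(\<integral>\<^sup>+a'\<in>{0..1}. (\<integral>\<^sup>+b'\<in>{0..1}. ennreal (128 * \<eta> / (\<bar>a' - a\<bar> + \<eta>) + 128 * \<eta> / (\<bar>b' - b\<bar> + \<eta>)
        + 8000 * \<eta> * ln (1 + 1 / sqrt \<eta>) / (sqrt \<bar>a' - a\<bar> * sqrt \<bar>b' - b\<bar>)) \<partial>lborel) \<partial>lborel)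
    = (\<integral>\<^sup>+a'\<in>{0..1}. (ennreal (128 * \<eta>) * f a a' + ennreal (128 * \<eta>) * (\<integral>\<^sup>+b'\<in>{0..1}. f b b' \<partial>lborel)
        + ennreal (8000 * \<eta> * L) * (g a a' * (\<integral>\<^sup>+b'\<in>{0..1}. g b b' \<partial>lborel))) \<partial>lborel)"
    unfolding inner ..
  also have "\<dots> = ennreal (128 * \<eta>) * (\<integral>\<^sup>+a'\<in>{0..1}. f a a' \<partial>lborel) + ennreal (128 * \<eta>) * (\<integral>\<^sup>+b'\<in>{0..1}. f b b' \<partial>lborel)
        + ennreal (8000 * \<eta> * L) * ((\<integral>\<^sup>+b'\<in>{0..1}. g b b' \<partial>lborel) * (\<integral>\<^sup>+a'\<in>{0..1}. g a a' \<partial>lborel))"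
    by (simp add: distrib_right mult.assoc nn_integral_add nn_integral_cmult nn_integral_multc I1
        mult.left_commute[of "g a _" "\<integral>\<^sup>+b'. _ b' \<partial>lborel"])
  also have "\<dots> \<le> ennreal (128 * \<eta>) * ennreal (2 * \<Lambda>) + ennreal (128 * \<eta>) * ennreal (2 * \<Lambda>)
        + ennreal (8000 * \<eta> * L) * (4 * 4)"
    by (intro add_mono mult_mono f g mult_left_mono) auto
  also have "\<dots> = ennreal (512 * \<eta> * \<Lambda> + 128000 * \<eta> * L)"
  proof -
    have "0 \<le> \<Lambda>" using L by simp
    have "ennreal (8000 * \<eta> * L) * (4 * 4) = ennreal (8000 * \<eta> * L * 16)"
      using ennreal_mult[of "8000 * \<eta> * L" 16] \<eta> L by simp
    then show ?thesis using \<eta> L \<open>0 \<le> \<Lambda>\<close> by (simp add: mult_ac flip: ennreal_mult ennreal_plus)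
  qed
  \<comment> \<open>With \<open>\<eta> = 2 * \<delta>\<close> the exact constant is
    \<open>1024 + 256000 = 257024\<close>.\<close>
  also have "\<dots> \<le> ennreal (260000 * \<delta> * \<Lambda>)"
  proof (rule ennreal_leI)
    have "\<eta> * L \<le> \<eta> * \<Lambda>" using \<eta> L by simp
    moreover have "0 \<le> \<delta> * \<Lambda>" using assms L by simp
    ultimately show "512 * \<eta> * \<Lambda> + 128000 * \<eta> * L \<le> 260000 * \<delta> * \<Lambda>"
      unfolding \<eta>_def by (simp add: algebra_simps)
  qed
  finally show ?thesis unfolding \<Lambda>_def .
qed

section \<open>Square-integral bounds for one piece, first on a square of centres, then
  globally\<close>

lemma emeasure_lborel_cball_translate:
  fixes x :: "'a::euclidean_space"
  shows "emeasure lborel (cball x \<rho>) = emeasure lborel (cball 0 \<rho> :: 'a set)"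
proof -
  have "emeasure lborel (cball 0 \<rho> :: 'a set) = (\<integral>\<^sup>+(y::'a). indicator (cball 0 \<rho>) y \<partial>lborel)" by simp
  also have "\<dots> = (\<integral>\<^sup>+y. indicator (cball 0 \<rho>) (y + (- x)) \<partial>lborel)"
    by (rule nn_integral_lborel_translate[symmetric]) (intro borel_measurable_indicator, simp)
  also have "\<dots> = (\<integral>\<^sup>+y. indicator (cball x \<rho>) y \<partial>lborel)"
    by (intro nn_integral_cong) (auto simp: dist_norm norm_minus_commute split: split_indicator)
  finally show ?thesis by simp
qed

text \<open>It is not normalised: the measure of the annulus is bounded below uniformly in the radii
  and is divided out at the end.\<close>

definition piece_integral ::
    "'n::finite \<Rightarrow> real \<Rightarrow> (real ^ 'n \<Rightarrow> ennreal) \<Rightarrow> real ^ 'n \<Rightarrow> real ^ 'n \<Rightarrow> ennreal" where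
  "piece_integral i \<delta> h r x = (\<integral>\<^sup>+y. indicator (annulus_piece i \<delta> x r) y * h y \<partial>lborel)"

lemma piece_integral_measurable [measurable (raw)]:
  fixes f g :: "'a \<Rightarrow> real ^ 'n::finite"
  assumes [measurable]: "f \<in> borel_measurable M" "g \<in> borel_measurable M" "h \<in> borel_measurable borel"
  shows "(\<lambda>p. piece_integral i \<delta> h (g p) (f p)) \<in> borel_measurable M"
  unfolding piece_integral_def by measurable

text \<open>With the radius chosen measurably, the Schur kernel is the measure of the intersection
  of two pieces whose centres lie in the same square, which
  \<open>emeasure_annulus_piece_inter\<close> controls. In \<open>\<rho>\<close>, 2 bounds the
  distance of a centre from \<open>x0\<close>, \<open>3 * CARD('n)\<close> the extent of the
  annulus, and 3 the shifts used in the intersection estimate.\<close>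

lemma nn_integral_square_max_piece_integral_square:
  fixes \<delta> :: real and x0 :: "real ^ 'n::finite" and h :: "real ^ 'n \<Rightarrow> ennreal"
  assumes ijk: "i \<noteq> j" "i \<noteq> k" "j \<noteq> k"
    and \<delta>: "0 < \<delta>" "\<delta> < 1"
    and R: "finite R" "R \<noteq> {}" "R \<subseteq> {r. \<forall>l. r $ l \<in> {1..2}}"
    and h [measurable]: "h \<in> borel_measurable borel"
  defines "\<rho> \<equiv> 3 * real CARD('n) + 5"
  defines "V \<equiv> measure lborel (cball 0 \<rho> :: (real ^ 'n) set)"
  shows "(\<integral>\<^sup>+a\<in>{0..1}. (\<integral>\<^sup>+b\<in>{0..1}. (SUP r\<in>R. piece_integral i \<delta> h r (x0 + a *\<^sub>R axis j 1 + b *\<^sub>R axis k 1))\<^sup>2 \<partial>lborel) \<partial>lborel)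
    \<le> ennreal (V * (32 * CARD('n) * 260000) * \<delta>\<^sup>2 * ln (1 + 1 / \<delta>)) * (\<integral>\<^sup>+y\<in>cball x0 \<rho>. (h y)\<^sup>2 \<partial>lborel)"
    (is "_ \<le> ennreal ?B * ?H")
proof (cases "?H = \<infinity>")
  case True
  \<comment> \<open>Since \<open>0 * \<infinity> = 0\<close> in \<open>ennreal\<close>, the infinite
    case rests on a positive constant.\<close>
  have "0 < V"
    unfolding V_def \<rho>_def by (intro content_cball_pos[unfolded measure_completion]) simp
  then have "0 < ?B" using \<delta> by (auto intro!: mult_pos_pos ln_gt_zero)
  then have "ennreal ?B \<noteq> 0" by (metis ennreal_eq_0_iff not_le)
  then have "ennreal ?B * ?H = \<infinity>" unfolding True infinity_ennreal_def by (simp only: ennreal_mult_eq_top_iff) simp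
  then show ?thesis by simp
next
  case False
  define K where "K = cball x0 \<rho>"
  have K [measurable]: "K \<in> sets borel" by (simp add: K_def)
  have emK: "emeasure lborel K = ennreal V"
    unfolding K_def V_def emeasure_lborel_cball_translate[of x0]
    using emeasure_lborel_cball_finite[of "0 :: real ^ 'n" \<rho>] by (intro emeasure_eq_ennreal_measure) auto
  have V: "0 < V"
    unfolding V_def \<rho>_def by (intro content_cball_pos[unfolded measure_completion]) simp
  define X where "X p = x0 + fst p *\<^sub>R axis j 1 + snd p *\<^sub>R axis k 1" for p :: "real \<times> real"
  have X [measurable]: "X \<in> borel_measurable borel"
    unfolding X_def by (intro borel_measurable_continuous_onI continuous_intros)
  define Q where "Q = ({0..1} \<times> {0..1} :: (real \<times> real) set)"
  have Q [measurable]: "Q \<in> sets borel" unfolding Q_def by (intro borel_closed closed_Times) auto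
  define P :: "(real \<times> real) measure" where "P = lborel"
  have sets_P [measurable_cong]: "sets P = sets borel" by (simp add: P_def)
  have P: "P = lborel \<Otimes>\<^sub>M lborel" by (simp add: P_def lborel_prod)
  have iter: "(\<integral>\<^sup>+p. \<phi> p \<partial>P) = (\<integral>\<^sup>+a. (\<integral>\<^sup>+b. \<phi> (a, b) \<partial>lborel) \<partial>lborel)"
    if "\<phi> \<in> borel_measurable P" for \<phi> :: "real \<times> real \<Rightarrow> ennreal"
    using lborel.nn_integral_fst[of \<phi> lborel] that unfolding P by simp
  define U where "U r p = piece_integral i \<delta> h r (X p)" for r p
  have U: "U r \<in> borel_measurable P" for r unfolding U_def by measurable
  obtain \<sigma> where \<sigma> [measurable]: "\<sigma> \<in> borel_measurable P" and \<sigma>R: "\<And>p. \<sigma> p \<in> R"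
    and \<sigma>max: "\<And>p r. r \<in> R \<Longrightarrow> U r p \<le> U (\<sigma> p) p"
    using measurable_argmax_exists[of R U P, OF R(1,2) U] by blast
  have r\<sigma>: "\<forall>l. \<sigma> p $ l \<in> {1..2}" for p using \<sigma>R[of p] R(3) by auto
  define \<psi> where "\<psi> p y = (indicator Q p * indicator (annulus_piece i \<delta> (X p) (\<sigma> p)) y :: ennreal)" for p y
  have \<psi> [measurable]: "case_prod \<psi> \<in> borel_measurable (P \<Otimes>\<^sub>M lborel)"
    unfolding \<psi>_def by measurable
  \<comment> \<open>Pieces with centre in the square lie in \<open>K\<close>, so the cut-off does
    not change \<open>u\<close>, while it localises the right-hand side.\<close>
  define h' where "h' y = indicator K y * h y" for y
  have h' [measurable]: "h' \<in> borel_measurable lborel" unfolding h'_def by measurable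
  have normX: "norm (X p - x0) \<le> 2" if "p \<in> Q" for p
  proof -
    have "norm (fst p *\<^sub>R axis j 1 + (snd p *\<^sub>R axis k 1 :: real ^ 'n)) \<le> 1 + 1"
      using that by (intro norm_triangle_mono) (auto simp: Q_def)
    then show ?thesis by (simp add: X_def)
  qed
  have subK: "cball (X p) (3 * CARD('n) + 3) \<subseteq> K" if "p \<in> Q" for p
  proof
    fix y assume "y \<in> cball (X p) (3 * CARD('n) + 3)"
    then have "dist x0 y \<le> 2 + (3 * CARD('n) + 3)"
      using normX[OF that] dist_triangle[of x0 y "X p"] by (simp add: dist_norm norm_minus_commute)
    then show "y \<in> K" by (simp add: K_def \<rho>_def)
  qed
  have pieceK: "annulus_piece i \<delta> (X p) r \<subseteq> K" if "p \<in> Q" "\<forall>l. r $ l \<in> {1..2}" for p r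
  proof -
    have "annulus_piece i \<delta> (X p) r \<subseteq> cball (X p) (3 * CARD('n))"
      using ellipsoidal_annulus_subset_cball[OF _ that(2), of \<delta> "X p"] \<delta> by (auto simp: annulus_piece_def)
    also have "\<dots> \<subseteq> cball (X p) (3 * CARD('n) + 3)" by (rule subset_cball) simp
    also note subK[OF that(1)]
    finally show ?thesis .
  qed
  define u where "u p = (\<integral>\<^sup>+y. \<psi> p y * h' y \<partial>lborel)" for p
  have u_eq: "u p = indicator Q p * (SUP r\<in>R. U r p)" for p
  proof (cases "p \<in> Q")
    case True
    have "u p = U (\<sigma> p) p"
      unfolding u_def U_def piece_integral_def \<psi>_def h'_def
      using True pieceK[OF True r\<sigma>[of p]] by (intro nn_integral_cong) (auto split: split_indicator)
    also have "\<dots> = (SUP r\<in>R. U r p)"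
      using \<sigma>R[of p] \<sigma>max[of _ p] by (intro antisym SUP_least SUP_upper) auto
    finally show ?thesis using True by simp
  qed (simp add: u_def \<psi>_def)
  have u [measurable]: "u \<in> borel_measurable P" unfolding u_def by measurable
  have H: "(\<integral>\<^sup>+y. (h' y)\<^sup>2 \<partial>lborel) = ?H"
    unfolding h'_def K_def by (intro nn_integral_cong) (auto split: split_indicator)
  have fin: "(\<integral>\<^sup>+p. (u p)\<^sup>2 \<partial>P) < \<infinity>"
  proof -
    define c where "c = ennreal V + ?H"
    have "u p \<le> c * indicator Q p" for p
    proof (cases "p \<in> Q")
      case True
      \<comment> \<open>From \<open>t \<le> 1 + t^2\<close> on \<open>K\<close>, \<open>u\<close> is
        bounded by the finite constant \<open>V + ?H\<close>; this gives the finiteness that the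
        Schur test asks for.\<close>
      have le: "h' y \<le> indicator K y + (h' y)\<^sup>2" for y
      proof (cases "h' y \<le> 1")
        case True
        then show ?thesis by (auto simp: h'_def split: split_indicator intro: order_trans)
      next
        case False
        then have "h' y * 1 \<le> h' y * h' y" by (intro mult_left_mono) auto
        then show ?thesis by (simp add: power2_eq_square add_increasing)
      qed
      have "u p \<le> (\<integral>\<^sup>+y. indicator K y + (h' y)\<^sup>2 \<partial>lborel)"
        unfolding u_def
        by (intro nn_integral_mono order_trans[OF _ le]) (auto simp: \<psi>_def split: split_indicator)
      also have "\<dots> = c"
        unfolding c_def by (simp add: nn_integral_add H emK)
      finally show ?thesis using True by simp
    qed (simp add: u_def \<psi>_def)
    then have "(\<integral>\<^sup>+p. (u p)\<^sup>2 \<partial>P) \<le> (\<integral>\<^sup>+p. (c * indicator Q p)\<^sup>2 \<partial>P)"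
      by (intro nn_integral_mono power_mono) auto
    also have "\<dots> = (\<integral>\<^sup>+p. c\<^sup>2 * indicator Q p \<partial>P)"
      by (intro nn_integral_cong) (auto split: split_indicator)
    also have "\<dots> = c\<^sup>2 * emeasure P Q"
      by (rule nn_integral_cmult_indicator) measurable
    also have "emeasure P Q = 1"
      unfolding P Q_def by (subst lborel.emeasure_pair_measure_Times) auto
    also have "c\<^sup>2 * 1 < \<infinity>"
      using False by (simp add: c_def power2_eq_square ennreal_mult_less_top less_top)
    finally show ?thesis .
  qed
  have kernel: "(\<integral>\<^sup>+q. (\<integral>\<^sup>+y. \<psi> p y * \<psi> q y \<partial>lborel) \<partial>P) \<le> ennreal ?B" for p
  proof (cases "p \<in> Q")
    case True
    have pP: "p \<in> space P" by (simp add: P_def)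
    define \<eta> where "\<eta> = 2 * \<delta>"
    define Y where "Y a' b' = ennreal (128 * \<eta> / (\<bar>a' - fst p\<bar> + \<eta>) + 128 * \<eta> / (\<bar>b' - snd p\<bar> + \<eta>)
        + 8000 * \<eta> * ln (1 + 1 / sqrt \<eta>) / (sqrt \<bar>a' - fst p\<bar> * sqrt \<bar>b' - snd p\<bar>))" for a' b'
    define C where "C = ennreal V * ennreal (32 * CARD('n) * \<delta>)"
    have [measurable]: "(\<lambda>b'. Y a' b') \<in> borel_measurable borel"
      "(\<lambda>p. Y (fst p) (snd p)) \<in> borel_measurable (borel \<Otimes>\<^sub>M borel)" for a'
      unfolding Y_def by measurable
    \<comment> \<open>The intersection estimate requires both displacements to be nonzero. The two
      excluded lines through \<open>p\<close> are null and are handled by almost-everywhere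
      comparison below.\<close>
    have k: "(\<integral>\<^sup>+y. \<psi> p y * \<psi> (a', b') y \<partial>lborel) \<le> C * (Y a' b' * indicator {0..1} b' * indicator {0..1} a')"
      if ne: "a' \<noteq> fst p" "b' \<noteq> snd p" for a' b'
    proof (cases "(a', b') \<in> Q")
      case q: True
      have X': "X (a', b') = X p + (a' - fst p) *\<^sub>R axis j 1 + (b' - snd p) *\<^sub>R axis k 1"
        by (simp add: X_def algebra_simps)
      have "(\<integral>\<^sup>+y. \<psi> p y * \<psi> (a', b') y \<partial>lborel)
        = (\<integral>\<^sup>+y. indicator (annulus_piece i \<delta> (X p) (\<sigma> p) \<inter> annulus_piece i \<delta> (X (a', b')) (\<sigma> (a', b'))) y \<partial>lborel)"
        using True q by (intro nn_integral_cong) (auto simp: \<psi>_def split: split_indicator)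
      also have "\<dots> = emeasure lborel (annulus_piece i \<delta> (X p) (\<sigma> p) \<inter> annulus_piece i \<delta> (X (a', b')) (\<sigma> (a', b')))"
        by simp
      also have "\<dots> \<le> emeasure lborel K * (ennreal (32 * CARD('n) * \<delta>) * Y a' b')"
        unfolding X' Y_def \<eta>_def using ne
        by (intro emeasure_annulus_piece_inter ijk \<delta> r\<sigma> subK[OF True] K) auto
      finally show ?thesis using q by (simp add: Q_def C_def emK mult.assoc)
    qed (simp add: \<psi>_def)
    have "(\<integral>\<^sup>+q. (\<integral>\<^sup>+y. \<psi> p y * \<psi> q y \<partial>lborel) \<partial>P)
      = (\<integral>\<^sup>+a'. (\<integral>\<^sup>+b'. (\<integral>\<^sup>+y. \<psi> p y * \<psi> (a', b') y \<partial>lborel) \<partial>lborel) \<partial>lborel)"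
      using pP by (intro iter) measurable
    also have "\<dots> \<le> (\<integral>\<^sup>+a'. (\<integral>\<^sup>+b'. C * (Y a' b' * indicator {0..1} b' * indicator {0..1} a') \<partial>lborel) \<partial>lborel)"
    proof (rule nn_integral_mono_AE)
      show "AE a' in lborel. (\<integral>\<^sup>+b'. (\<integral>\<^sup>+y. \<psi> p y * \<psi> (a', b') y \<partial>lborel) \<partial>lborel)
        \<le> (\<integral>\<^sup>+b'. C * (Y a' b' * indicator {0..1} b' * indicator {0..1} a') \<partial>lborel)"
        using AE_lborel_singleton[of "fst p"]
      proof eventually_elim
        case (elim a')
        show ?case
        proof (rule nn_integral_mono_AE)
          show "AE b' in lborel. (\<integral>\<^sup>+y. \<psi> p y * \<psi> (a', b') y \<partial>lborel)
            \<le> C * (Y a' b' * indicator {0..1} b' * indicator {0..1} a')"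
            using AE_lborel_singleton[of "snd p"] by eventually_elim (rule k[OF elim])
        qed
      qed
    qed
    also have "\<dots> = C * (\<integral>\<^sup>+a'\<in>{0..1}. (\<integral>\<^sup>+b'\<in>{0..1}. Y a' b' \<partial>lborel) \<partial>lborel)"
      by (simp add: nn_integral_cmult nn_integral_multc)
    also have "\<dots> \<le> C * ennreal (260000 * \<delta> * ln (1 + 1 / \<delta>))"
      unfolding Y_def \<eta>_def by (intro mult_left_mono nn_integral_kernel_bound \<delta>) auto
    also have "\<dots> = ennreal ?B"
      unfolding C_def using V \<delta> by (simp add: power2_eq_square mult_ac flip: ennreal_mult)
    finally show ?thesis .
  qed (simp add: \<psi>_def)
  have "(\<integral>\<^sup>+p. (u p)\<^sup>2 \<partial>P) \<le> ennreal ?B * (\<integral>\<^sup>+y. (h' y)\<^sup>2 \<partial>lborel)"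
    unfolding u_def
  proof (rule nn_integral_square_le_of_schur)
    show "sigma_finite_measure P" unfolding P_def by (rule sigma_finite_lborel)
    show "0 < ?B" using V \<delta> by (auto intro!: mult_pos_pos ln_gt_zero)
    show "(\<integral>\<^sup>+p. (\<integral>\<^sup>+y. \<psi> p y * h' y \<partial>lborel)\<^sup>2 \<partial>P) < \<infinity>" using fin unfolding u_def .
  qed (use kernel in \<open>simp_all add: sigma_finite_lborel\<close>)
  moreover have "(\<integral>\<^sup>+p. (u p)\<^sup>2 \<partial>P) = (\<integral>\<^sup>+a. (\<integral>\<^sup>+b. (u (a, b))\<^sup>2 \<partial>lborel) \<partial>lborel)"
    by (rule iter) measurable
  moreover have "\<dots> = (\<integral>\<^sup>+a\<in>{0..1}. (\<integral>\<^sup>+b\<in>{0..1}. (SUP r\<in>R. piece_integral i \<delta> h r (x0 + a *\<^sub>R axis j 1 + b *\<^sub>R axis k 1))\<^sup>2 \<partial>lborel) \<partial>lborel)"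
    unfolding u_eq U_def X_def
    by (intro nn_integral_cong) (auto simp: Q_def intro!: nn_integral_cong split: split_indicator)
  ultimately show ?thesis unfolding H by simp
qed

text \<open>The left-hand side is the integral over base points \<open>x\<close> of the local square
  integrals. On the right, Fubini counts each \<open>y\<close> for all \<open>x\<close> within
  distance \<open>\<rho>\<close>, which yields the second factor \<open>V\<close>.\<close>

lemma nn_integral_square_max_piece_integral:
  fixes \<delta> :: real and h :: "real ^ 'n::finite \<Rightarrow> ennreal"
  assumes ijk: "i \<noteq> j" "i \<noteq> k" "j \<noteq> k"
    and \<delta>: "0 < \<delta>" "\<delta> < 1"
    and R: "finite R" "R \<noteq> {}" "R \<subseteq> {r. \<forall>l. r $ l \<in> {1..2}}"
    and h [measurable]: "h \<in> borel_measurable borel"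
  defines "V \<equiv> measure lborel (cball 0 (3 * real CARD('n) + 5) :: (real ^ 'n) set)"
  shows "(\<integral>\<^sup>+x. (SUP r\<in>R. piece_integral i \<delta> h r x)\<^sup>2 \<partial>lborel)
    \<le> ennreal (V\<^sup>2 * (32 * CARD('n) * 260000) * \<delta>\<^sup>2 * ln (1 + 1 / \<delta>)) * (\<integral>\<^sup>+y. (h y)\<^sup>2 \<partial>lborel)"
proof -
  define \<rho> where "\<rho> = 3 * real CARD('n) + 5"
  define B where "B = V * (32 * CARD('n) * 260000) * \<delta>\<^sup>2 * ln (1 + 1 / \<delta>)"
  have V: "0 \<le> V" by (simp add: V_def)
  have emV: "emeasure lborel (cball y \<rho>) = ennreal V" for y :: "real ^ 'n"
    unfolding emeasure_lborel_cball_translate[of y] V_def \<rho>_def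
    using emeasure_lborel_cball_finite[of "0 :: real ^ 'n" "3 * real CARD('n) + 5"]
    by (intro emeasure_eq_ennreal_measure) auto
  have ind [measurable]: "(\<lambda>(x :: real ^ 'n, y). indicator (cball x \<rho>) y :: ennreal) \<in> borel_measurable (lborel \<Otimes>\<^sub>M lborel)"
  proof -
    have "(\<lambda>(x :: real ^ 'n, y). indicator (cball x \<rho>) y :: ennreal) = (\<lambda>p. if dist (fst p) (snd p :: real ^ 'n) \<le> \<rho> then 1 else 0)"
      by (auto simp: indicator_def fun_eq_iff)
    then show ?thesis by simp
  qed
  have [measurable]: "(\<lambda>x. (SUP r\<in>R. piece_integral i \<delta> h r x)\<^sup>2) \<in> borel_measurable borel"
    using countable_finite[OF R(1)] by measurable
  have "(\<integral>\<^sup>+x. (SUP r\<in>R. piece_integral i \<delta> h r x)\<^sup>2 \<partial>lborel)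
     = (\<integral>\<^sup>+x. (\<integral>\<^sup>+a\<in>{0..1}. (\<integral>\<^sup>+b\<in>{0..1}. (SUP r\<in>R. piece_integral i \<delta> h r (x + a *\<^sub>R axis j 1 + b *\<^sub>R axis k 1))\<^sup>2 \<partial>lborel) \<partial>lborel) \<partial>lborel)"
    by (rule nn_integral_shift_average2[symmetric]) measurable
  also have "\<dots> \<le> (\<integral>\<^sup>+x. ennreal B * (\<integral>\<^sup>+y\<in>cball x \<rho>. (h y)\<^sup>2 \<partial>lborel) \<partial>lborel)"
    unfolding B_def \<rho>_def V_def
    by (rule nn_integral_mono) (rule nn_integral_square_max_piece_integral_square[OF ijk \<delta> R h])
  also have "\<dots> = ennreal B * (\<integral>\<^sup>+x. (\<integral>\<^sup>+y. (h y)\<^sup>2 * indicator (cball x \<rho>) y \<partial>lborel) \<partial>lborel)"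
    by (intro nn_integral_cmult) measurable
  also have "(\<integral>\<^sup>+x. (\<integral>\<^sup>+y. (h y)\<^sup>2 * indicator (cball x \<rho>) y \<partial>lborel) \<partial>lborel)
    = (\<integral>\<^sup>+y. (\<integral>\<^sup>+x. (h y)\<^sup>2 * indicator (cball x \<rho>) y \<partial>lborel) \<partial>lborel)"
    by (rule lborel_pair.Fubini'[symmetric]) measurable
  also have "\<dots> = (\<integral>\<^sup>+y. (h y)\<^sup>2 * ennreal V \<partial>lborel)"
  proof (rule nn_integral_cong)
    fix y :: "real ^ 'n"
    have "(\<integral>\<^sup>+x. (h y)\<^sup>2 * indicator (cball x \<rho>) y \<partial>lborel) = (\<integral>\<^sup>+x. (h y)\<^sup>2 * indicator (cball y \<rho>) x \<partial>lborel)"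
      by (intro nn_integral_cong) (auto simp: dist_commute split: split_indicator)
    also have "\<dots> = (h y)\<^sup>2 * emeasure lborel (cball y \<rho>)"
      by (rule nn_integral_cmult_indicator) simp
    finally show "(\<integral>\<^sup>+x. (h y)\<^sup>2 * indicator (cball x \<rho>) y \<partial>lborel) = (h y)\<^sup>2 * ennreal V"
      by (simp add: emV)
  qed
  also have "\<dots> = ennreal V * (\<integral>\<^sup>+y. (h y)\<^sup>2 \<partial>lborel)"
    by (simp add: nn_integral_cmult mult.commute[of _ "ennreal V"])
  also have "ennreal B * (ennreal V * (\<integral>\<^sup>+y. (h y)\<^sup>2 \<partial>lborel)) = ennreal (B * V) * (\<integral>\<^sup>+y. (h y)\<^sup>2 \<partial>lborel)"
    using V \<delta> by (simp add: ennreal_mult B_def mult.assoc)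
  also have "B * V = V\<^sup>2 * (32 * CARD('n) * 260000) * \<delta>\<^sup>2 * ln (1 + 1 / \<delta>)"
    by (simp add: B_def power2_eq_square mult_ac)
  finally show ?thesis .
qed

section \<open>The maximal function\<close>

lemma SUP_power2_le_of_incseq:
  fixes a :: "nat \<Rightarrow> ennreal"
  assumes "incseq a"
  shows "(SUP n. a n)\<^sup>2 \<le> (SUP n. (a n)\<^sup>2)"
proof -
  have "(SUP n. a n)\<^sup>2 = (SUP n. a n * (SUP m. a m))"
    unfolding power2_eq_square by (rule SUP_mult_right_ennreal)
  also have "\<dots> = (SUP n. SUP m. a n * a m)"
    by (simp add: SUP_mult_left_ennreal)
  also have "\<dots> \<le> (SUP n. (a n)\<^sup>2)"
  proof (intro SUP_least)
    fix n m
    have "a n * a m \<le> (a (max n m))\<^sup>2"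
      unfolding power2_eq_square using assms by (intro mult_mono) (auto simp: incseq_def)
    then show "a n * a m \<le> (SUP n. (a n)\<^sup>2)" by (rule SUP_upper2[rotated]) simp
  qed
  finally show ?thesis .
qed

text \<open>The bound \<open>C\<close> does not depend on the number of functions, so it survives
  monotone convergence along initial segments of an enumeration of \<open>D\<close>.\<close>

lemma nn_integral_square_countable_SUP_le:
  fixes F :: "'b \<Rightarrow> 'a \<Rightarrow> ennreal"
  assumes D: "countable D" "D \<noteq> {}"
    and meas [measurable]: "\<And>r. r \<in> D \<Longrightarrow> F r \<in> borel_measurable M"
    and fin: "\<And>R. finite R \<Longrightarrow> R \<noteq> {} \<Longrightarrow> R \<subseteq> D \<Longrightarrow> (\<integral>\<^sup>+x. (SUP r\<in>R. F r x)\<^sup>2 \<partial>M) \<le> C"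
  shows "(\<integral>\<^sup>+x. (SUP r\<in>D. F r x)\<^sup>2 \<partial>M) \<le> C"
proof -
  define e where "e = from_nat_into D"
  have e: "range e = D" unfolding e_def using D by (intro range_from_nat_into)
  define a where "a n x = (SUP r\<in>e ` {..n}. F r x)" for n x
  have inc: "incseq (\<lambda>n. a n x)" for x
    unfolding a_def incseq_def by (auto intro!: SUP_subset_mono)
  have [measurable]: "a n \<in> borel_measurable M" for n
    unfolding a_def using e by (intro borel_measurable_SUP meas) auto
  have "(SUP r\<in>D. F r x) \<le> (SUP n. a n x)" for x
  proof (rule SUP_least)
    fix r assume "r \<in> D"
    then obtain n where "r = e n" using e by auto
    then have "F r x \<le> a n x" unfolding a_def by (auto intro: SUP_upper)
    then show "F r x \<le> (SUP n. a n x)" by (rule SUP_upper2[rotated]) simp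
  qed
  then have "(SUP r\<in>D. F r x)\<^sup>2 \<le> (SUP n. (a n x)\<^sup>2)" for x
    using SUP_power2_le_of_incseq[OF inc[of x]] by (meson order_trans power_mono zero_le)
  then have "(\<integral>\<^sup>+x. (SUP r\<in>D. F r x)\<^sup>2 \<partial>M) \<le> (\<integral>\<^sup>+x. (SUP n. (a n x)\<^sup>2) \<partial>M)"
    by (intro nn_integral_mono)
  also have "\<dots> = (SUP n. (\<integral>\<^sup>+x. (a n x)\<^sup>2 \<partial>M))"
    using inc by (intro nn_integral_monotone_convergence_SUP)
      (auto simp: incseq_def le_fun_def intro!: power_mono)
  also have "\<dots> \<le> C"
    unfolding a_def using e by (intro SUP_least fin) auto
  finally show ?thesis .
qed

lemma ellipsoidal_annulus_measurable [measurable]: "ellipsoidal_annulus \<delta> x r \<in> sets borel"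
  unfolding ellipsoidal_annulus_def ellipsoid_fun_def by simp

text \<open>The annulus is defined by a strict inequality, so a point of it remains in the annuli
  with nearby radii. The integral is therefore lower semicontinuous in the radii by Fatou's lemma,
  and a dense set of radii suffices.\<close>

lemma nn_integral_annulus_le_SUP_dense:
  fixes h :: "real ^ 'n::finite \<Rightarrow> ennreal"
  assumes h [measurable]: "h \<in> borel_measurable borel"
    and r: "r \<in> closure D" and pos: "\<forall>l. r $ l \<noteq> 0"
  shows "(\<integral>\<^sup>+y. indicator (ellipsoidal_annulus \<delta> x r) y * h y \<partial>lborel)
    \<le> (SUP r\<in>D. \<integral>\<^sup>+y. indicator (ellipsoidal_annulus \<delta> x r) y * h y \<partial>lborel)"
proof -
  obtain q where q: "\<And>m. q m \<in> D" and lim: "q \<longlonglongrightarrow> r"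
    using r unfolding closure_sequential by blast
  have pw: "indicator (ellipsoidal_annulus \<delta> x r) y * h y
      \<le> liminf (\<lambda>m. indicator (ellipsoidal_annulus \<delta> x (q m)) y * h y)" for y
  proof (cases "y \<in> ellipsoidal_annulus \<delta> x r")
    case True
    have "(\<lambda>m. \<bar>ellipsoid_fun x (q m) y\<bar>) \<longlonglongrightarrow> \<bar>ellipsoid_fun x r y\<bar>"
      unfolding ellipsoid_fun_def using pos by (intro tendsto_intros lim) auto
    then have "eventually (\<lambda>m. \<bar>ellipsoid_fun x (q m) y\<bar> < \<delta>) sequentially"
      using True by (intro order_tendstoD(2)) (auto simp: ellipsoidal_annulus_def)
    then have "eventually (\<lambda>m. indicator (ellipsoidal_annulus \<delta> x r) y * h y
        \<le> indicator (ellipsoidal_annulus \<delta> x (q m)) y * h y) sequentially"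
      by eventually_elim (use True in \<open>simp add: ellipsoidal_annulus_def\<close>)
    then show ?thesis by (rule Liminf_bounded)
  qed simp
  have "(\<integral>\<^sup>+y. indicator (ellipsoidal_annulus \<delta> x r) y * h y \<partial>lborel)
    \<le> (\<integral>\<^sup>+y. liminf (\<lambda>m. indicator (ellipsoidal_annulus \<delta> x (q m)) y * h y) \<partial>lborel)"
    by (intro nn_integral_mono pw)
  also have "\<dots> \<le> liminf (\<lambda>m. \<integral>\<^sup>+y. indicator (ellipsoidal_annulus \<delta> x (q m)) y * h y \<partial>lborel)"
    by (rule nn_integral_liminf) measurable
  also have "\<dots> \<le> limsup (\<lambda>m. \<integral>\<^sup>+y. indicator (ellipsoidal_annulus \<delta> x (q m)) y * h y \<partial>lborel)"
    by (rule Liminf_le_Limsup) simp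
  also have "\<dots> \<le> (SUP r\<in>D. \<integral>\<^sup>+y. indicator (ellipsoidal_annulus \<delta> x r) y * h y \<partial>lborel)"
    using q by (intro Limsup_bounded always_eventually allI SUP_upper)
  finally show ?thesis .
qed

section \<open>Splitting into pieces and the volume of the annulus\<close>

lemma ellipsoidal_annulus_subset_pieces:
  fixes x r :: "real ^ 'n::finite"
  assumes "y \<in> ellipsoidal_annulus \<delta> x r"
  shows "\<exists>i. y \<in> annulus_piece i \<delta> x r"
proof (rule ccontr)
  assume "\<not> ?thesis"
  then have "(y $ i - x $ i)\<^sup>2 / (r $ i)\<^sup>2 < (1 - \<delta>) / CARD('n)" for i
    using assms by (auto simp: annulus_piece_def not_le)
  then have "(\<Sum>i\<in>UNIV. (y $ i - x $ i)\<^sup>2 / (r $ i)\<^sup>2) < (\<Sum>i\<in>(UNIV::'n set). (1 - \<delta>) / CARD('n))"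
    by (intro sum_strict_mono) auto
  then show False
    using assms by (simp add: ellipsoidal_annulus_def ellipsoid_fun_def)
qed

lemma nn_integral_annulus_le_sum_pieces:
  fixes h :: "real ^ 'n::finite \<Rightarrow> ennreal"
  assumes h [measurable]: "h \<in> borel_measurable borel"
  shows "(\<integral>\<^sup>+y. indicator (ellipsoidal_annulus \<delta> x r) y * h y \<partial>lborel) \<le> (\<Sum>i\<in>UNIV. piece_integral i \<delta> h r x)"
proof -
  have "indicator (ellipsoidal_annulus \<delta> x r) y * h y \<le> (\<Sum>i\<in>UNIV. indicator (annulus_piece i \<delta> x r) y * h y)" for y
  proof (cases "y \<in> ellipsoidal_annulus \<delta> x r")
    case True
    then obtain i where "y \<in> annulus_piece i \<delta> x r" using ellipsoidal_annulus_subset_pieces by blast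
    then have "h y = indicator (annulus_piece i \<delta> x r) y * h y" by simp
    also have "\<dots> \<le> (\<Sum>i\<in>UNIV. indicator (annulus_piece i \<delta> x r) y * h y)"
      by (rule member_le_sum) auto
    finally show ?thesis using True by simp
  qed simp
  then have "(\<integral>\<^sup>+y. indicator (ellipsoidal_annulus \<delta> x r) y * h y \<partial>lborel)
    \<le> (\<integral>\<^sup>+y. (\<Sum>i\<in>UNIV. indicator (annulus_piece i \<delta> x r) y * h y) \<partial>lborel)"
    by (intro nn_integral_mono)
  also have "\<dots> = (\<Sum>i\<in>UNIV. piece_integral i \<delta> h r x)"
    unfolding piece_integral_def by (rule nn_integral_sum) measurable
  finally show ?thesis .
qed

text \<open>The solid ellipsoid \<open>C t\<close> scales like the power \<open>CARD('n) / 2\<close>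
  of \<open>t\<close>, and the shell between levels \<open>1 - \<delta>\<close> and
  \<open>1 + \<delta> / 2\<close> lies in the annulus. The closed outer level
  \<open>1 + \<delta> / 2\<close> respects the strict inequality and still leaves
  \<open>3 * \<delta> / 2 \<ge> \<delta>\<close>. Radii of at least 1 put a unit ball inside
  \<open>C 1\<close>.\<close>

lemma emeasure_ellipsoidal_annulus_ge:
  fixes x r :: "real ^ 'n::finite"
  assumes n: "2 \<le> CARD('n)" and \<delta>: "0 < \<delta>" "\<delta> < 1" and r: "\<forall>l. r $ l \<in> {1..2}"
  shows "ennreal (measure lborel (cball 0 1 :: (real ^ 'n) set) * \<delta>) \<le> emeasure lebesgue (ellipsoidal_annulus \<delta> x r)"
proof -
  define q where "q z = (\<Sum>l\<in>UNIV. (z $ l)\<^sup>2 / (r $ l)\<^sup>2)" for z :: "real ^ 'n"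
  define C where "C t = {y. q (y - x) \<le> t}" for t
  have C_borel [measurable]: "C t \<in> sets borel" for t
    unfolding C_def q_def by simp
  have q_scale: "q (s *\<^sub>R z) = s\<^sup>2 * q z" for s z
    unfolding q_def by (simp add: sum_distrib_left power_mult_distrib)
  have scaled: "emeasure lebesgue (C t) = ennreal (sqrt t ^ CARD('n)) * emeasure lebesgue (C 1)" if t: "0 < t" for t
  proof -
    \<comment> \<open>\<open>C t\<close> is the dilate of \<open>C 1\<close> about \<open>x\<close>
      by the factor \<open>sqrt t\<close>.\<close>
    have "C t = (\<lambda>y. sqrt t *\<^sub>R y + (1 - sqrt t) *\<^sub>R x) ` C 1"
    proof (intro equalityI subsetI)
      fix y assume y: "y \<in> C t"
      define z where "z = x + (1 / sqrt t) *\<^sub>R (y - x)"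
      have "q (z - x) = q (y - x) / t"
        using t by (simp add: z_def q_scale power_one_over)
      then have "z \<in> C 1" using y t by (simp add: C_def)
      moreover have "y = sqrt t *\<^sub>R z + (1 - sqrt t) *\<^sub>R x"
        using t by (simp add: z_def algebra_simps)
      ultimately show "y \<in> (\<lambda>y. sqrt t *\<^sub>R y + (1 - sqrt t) *\<^sub>R x) ` C 1" by blast
    next
      fix y assume "y \<in> (\<lambda>y. sqrt t *\<^sub>R y + (1 - sqrt t) *\<^sub>R x) ` C 1"
      then obtain z where z: "z \<in> C 1" "y = sqrt t *\<^sub>R z + (1 - sqrt t) *\<^sub>R x" by blast
      then have "y - x = sqrt t *\<^sub>R (z - x)" by (simp add: algebra_simps)
      then have "q (y - x) = t * q (z - x)" using t by (simp add: q_scale)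
      then show "y \<in> C t" using z t mult_left_mono[of "q (z - x)" 1 t] by (simp add: C_def)
    qed
    then show ?thesis
      using emeasure_lebesgue_affine[of "sqrt t" "(1 - sqrt t) *\<^sub>R x" "C 1"] t
      by (simp add: ennreal_power)
  qed
  have ball: "cball x 1 \<subseteq> C 1"
  proof
    fix y assume "y \<in> cball x 1"
    then have "norm (y - x) \<le> 1" by (simp add: dist_norm norm_minus_commute)
    then have "(norm (y - x))\<^sup>2 \<le> 1" by (simp add: power_le_one)
    have "q (y - x) \<le> (\<Sum>l\<in>UNIV. ((y - x) $ l)\<^sup>2)"
      unfolding q_def
    proof (rule sum_mono)
      fix l
      show "((y - x) $ l)\<^sup>2 / (r $ l)\<^sup>2 \<le> ((y - x) $ l)\<^sup>2"
        using mult_left_mono[OF inverse_square_radius_bounds(2)[OF r[rule_format, of l]], of "((y - x) $ l)\<^sup>2"] by simp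
    qed
    also have "\<dots> = (norm (y - x))\<^sup>2"
      by (simp add: norm_vec_def L2_set_def sum_nonneg)
    also note \<open>(norm (y - x))\<^sup>2 \<le> 1\<close>
    finally show "y \<in> C 1" by (simp add: C_def)
  qed
  have sub1: "C 1 \<subseteq> cball x (3 * CARD('n))"
  proof
    fix y assume y: "y \<in> C 1"
    have "\<bar>(y - x) $ l\<bar> \<le> 3" for l
    proof -
      have "((y - x) $ l)\<^sup>2 / (r $ l)\<^sup>2 \<le> q (y - x)"
        unfolding q_def by (intro member_le_sum) auto
      then have "((y - x) $ l)\<^sup>2 * (1 / (r $ l)\<^sup>2) \<le> 1" using y by (simp add: C_def)
      moreover have "((y - x) $ l)\<^sup>2 * (1 / 4) \<le> ((y - x) $ l)\<^sup>2 * (1 / (r $ l)\<^sup>2)"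
        by (intro mult_left_mono inverse_square_radius_bounds(1) r[rule_format]) auto
      ultimately have "((y - x) $ l)\<^sup>2 \<le> 3\<^sup>2" unfolding power2_eq_square by linarith
      then have "\<bar>(y - x) $ l\<bar> \<le> \<bar>3\<bar>" by (simp only: abs_le_square_iff)
      then show ?thesis by simp
    qed
    then have "(\<Sum>l\<in>UNIV. \<bar>(y - x) $ l\<bar>) \<le> (\<Sum>l\<in>(UNIV::'n set). 3)" by (intro sum_mono)
    then have "norm (y - x) \<le> 3 * CARD('n)" using norm_le_l1_cart[of "y - x"] by simp
    then show "y \<in> cball x (3 * CARD('n))" by (simp add: dist_norm norm_minus_commute)
  qed
  have finC: "emeasure lebesgue (C 1) < \<infinity>"
    using emeasure_mono[OF sub1, of lborel] emeasure_lborel_cball_finite[of x "3 * CARD('n)"]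
    by (auto intro: le_less_trans)
  define m where "m = measure lborel (C 1)"
  have em: "emeasure lebesgue (C 1) = ennreal m"
    using finC unfolding m_def by (simp add: emeasure_eq_ennreal_measure less_top)
  have m: "0 \<le> m" by (simp add: m_def)
  have scaled': "emeasure lebesgue (C t) = ennreal (sqrt t ^ CARD('n) * m)" if "0 < t" for t
    by (rule scaled[OF that, unfolded em, THEN trans]) (use that m in \<open>simp flip: ennreal_mult\<close>)
  have "ennreal (measure lborel (cball 0 1 :: (real ^ 'n) set)) = emeasure lborel (cball x 1)"
    using emeasure_lborel_cball_finite[of "0 :: real ^ 'n" 1]
    unfolding emeasure_lborel_cball_translate[of x] by (intro emeasure_eq_ennreal_measure[symmetric]) auto
  also have "\<dots> \<le> emeasure lborel (C 1)" by (rule emeasure_mono[OF ball]) simp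
  also have "\<dots> = ennreal m" using em by simp
  finally have vm: "measure lborel (cball 0 1 :: (real ^ 'n) set) \<le> m" using m by simp
  \<comment> \<open>An exponent of at least 2 undoes the root on both sides of 1, so the volume
    difference is at least linear in \<open>\<delta>\<close>.\<close>
  have low: "sqrt (1 - \<delta>) ^ CARD('n) \<le> 1 - \<delta>"
    using power_decreasing[OF n, of "sqrt (1 - \<delta>)"] \<delta> by simp
  have high: "1 + \<delta> / 2 \<le> sqrt (1 + \<delta> / 2) ^ CARD('n)"
    using power_increasing[OF n, of "sqrt (1 + \<delta> / 2)"] \<delta> by simp
  have "measure lborel (cball 0 1 :: (real ^ 'n) set) * \<delta> \<le> m * (sqrt (1 + \<delta> / 2) ^ CARD('n) - sqrt (1 - \<delta>) ^ CARD('n))"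
    using vm low high \<delta> m by (intro mult_mono) auto
  then have "ennreal (measure lborel (cball 0 1 :: (real ^ 'n) set) * \<delta>)
    \<le> ennreal (sqrt (1 + \<delta> / 2) ^ CARD('n) * m - sqrt (1 - \<delta>) ^ CARD('n) * m)"
    by (intro ennreal_leI) (simp add: algebra_simps)
  also have "\<dots> = emeasure lebesgue (C (1 + \<delta> / 2)) - emeasure lebesgue (C (1 - \<delta>))"
    using \<delta> m by (subst (1 2) scaled') (auto intro!: ennreal_minus[symmetric])
  also have "\<dots> = emeasure lebesgue (C (1 + \<delta> / 2) - C (1 - \<delta>))"
  proof (rule emeasure_Diff[symmetric])
    show "emeasure lebesgue (C (1 - \<delta>)) \<noteq> \<infinity>"
      using \<delta> by (subst scaled') auto
    show "C (1 - \<delta>) \<subseteq> C (1 + \<delta> / 2)" using \<delta> by (auto simp: C_def)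
  qed simp_all
  also have "\<dots> \<le> emeasure lebesgue (ellipsoidal_annulus \<delta> x r)"
    using \<delta> by (intro emeasure_mono) (auto simp: C_def q_def ellipsoidal_annulus_def ellipsoid_fun_def abs_less_iff)
  finally show ?thesis .
qed

section \<open>Assembly of the estimate for the maximal function\<close>

lemma sum_power2_le_card_mult:
  fixes a :: "'i \<Rightarrow> ennreal"
  assumes "finite I"
  shows "(\<Sum>i\<in>I. a i)\<^sup>2 \<le> of_nat (card I) * (\<Sum>i\<in>I. (a i)\<^sup>2)"
proof -
  have "2 * (\<Sum>i\<in>I. a i)\<^sup>2 = 2 * (\<Sum>i\<in>I. \<Sum>j\<in>I. a i * a j)"
    by (simp only: power2_eq_square sum_product)
  also have "\<dots> = (\<Sum>i\<in>I. \<Sum>j\<in>I. 2 * (a i * a j))"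
    by (simp only: sum_distrib_left)
  also have "\<dots> \<le> (\<Sum>i\<in>I. \<Sum>j\<in>I. (a i)\<^sup>2 + (a j)\<^sup>2)"
    by (intro sum_mono ennreal_two_mult_le_squares)
  also have "\<dots> = 2 * (of_nat (card I) * (\<Sum>i\<in>I. (a i)\<^sup>2))"
    by (simp add: sum.distrib mult_2 sum_distrib_left)
  finally show ?thesis by (subst (asm) ennreal_mult_le_mult_iff) auto
qed

lemma nn_integral_square_ellipsoidal_maximal:
  fixes f :: "real ^ 'n::finite \<Rightarrow> complex" and \<delta> :: real
  assumes n: "3 \<le> CARD('n)" and \<delta>: "0 < \<delta>" "\<delta> < 1" and f: "f \<in> borel_measurable lebesgue"
  defines "V \<equiv> measure lborel (cball 0 (3 * real CARD('n) + 5) :: (real ^ 'n) set)"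
    and "v \<equiv> measure lborel (cball 0 1 :: (real ^ 'n) set)"
  shows "(\<integral>\<^sup>+x. (ellipsoidal_maximal \<delta> f x)\<^sup>2 \<partial>lebesgue)
    \<le> ennreal ((real CARD('n))\<^sup>2 * V\<^sup>2 * (32 * CARD('n) * 260000) / v\<^sup>2 * ln (1 + 1 / \<delta>))
      * (\<integral>\<^sup>+x. (ennreal (norm (f x)))\<^sup>2 \<partial>lebesgue)"
proof -
  define B where "B = V\<^sup>2 * (32 * CARD('n) * 260000) * \<delta>\<^sup>2 * ln (1 + 1 / \<delta>)"
  have B: "0 \<le> B" unfolding B_def using \<delta> by (auto intro!: mult_nonneg_nonneg ln_ge_zero)
  have v: "0 < v"
    unfolding v_def by (intro content_cball_pos[unfolded measure_completion]) simp
  have "(\<lambda>y. ennreal (norm (f y))) \<in> borel_measurable lebesgue" using f by measurable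
  \<comment> \<open>A Borel version of the absolute value of \<open>f\<close>, agreeing with it
    almost everywhere, so that every annulus integral can be computed with
    \<open>lborel\<close>.\<close>
  then obtain h where h [measurable]: "h \<in> borel_measurable borel"
    and hf: "AE y in lborel. ennreal (norm (f y)) = h y"
    using completion_ex_borel_measurable[of "\<lambda>y. ennreal (norm (f y))" lborel] by auto
  define I where "I r x = (\<integral>\<^sup>+y. indicator (ellipsoidal_annulus \<delta> x r) y * h y \<partial>lborel)" for r x :: "real ^ 'n"
  have I: "(\<integral>\<^sup>+y\<in>ellipsoidal_annulus \<delta> x r. ennreal (norm (f y)) \<partial>lebesgue) = I r x" for x r
    unfolding I_def nn_integral_completion using hf
    by (intro nn_integral_cong_AE) (auto elim!: eventually_mono simp: mult.commute)
  define S where "S = {r :: real ^ 'n. \<forall>l. r $ l \<in> {1..2}}"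
  \<comment> \<open>A countable dense set inside the box itself, so that its elements are admissible
    radii and suprema over it are measurable.\<close>
  obtain D where D: "countable D" "D \<subseteq> S" "S \<subseteq> closure D" using separable by blast
  have "(\<chi> l. 1) \<in> S" by (simp add: S_def)
  then have Dne: "D \<noteq> {}" using D(3) by auto
  define N where "N i x = (SUP r\<in>D. piece_integral i \<delta> h r x)" for i x
  have N [measurable]: "N i \<in> borel_measurable borel" for i
    unfolding N_def using D(1) by measurable
  have I_le: "I r x \<le> (\<Sum>i\<in>UNIV. N i x)" if "r \<in> S" for r x
  proof -
    have "1 \<le> r $ l" for l using that by (simp add: S_def)
    then have "\<forall>l. r $ l \<noteq> 0" by (metis not_one_le_zero)
    then have "I r x \<le> (SUP r\<in>D. I r x)"
      unfolding I_def using that D(3) by (intro nn_integral_annulus_le_SUP_dense h) auto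
    also have "\<dots> \<le> (\<Sum>i\<in>UNIV. N i x)"
    proof (rule SUP_least)
      fix r assume r: "r \<in> D"
      have "I r x \<le> (\<Sum>i\<in>UNIV. piece_integral i \<delta> h r x)"
        unfolding I_def by (rule nn_integral_annulus_le_sum_pieces[OF h])
      also have "\<dots> \<le> (\<Sum>i\<in>UNIV. N i x)"
        unfolding N_def using r by (intro sum_mono SUP_upper)
      finally show "I r x \<le> (\<Sum>i\<in>UNIV. N i x)" .
    qed
    finally show ?thesis .
  qed
  \<comment> \<open>The lower bound \<open>v * \<delta>\<close> for the volumes does not depend on
    the radii, so the normalisation can be pulled out of the supremum.\<close>
  have M_le: "ellipsoidal_maximal \<delta> f x \<le> ennreal (1 / (v * \<delta>)) * (\<Sum>i\<in>UNIV. N i x)" for x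
    unfolding ellipsoidal_maximal_def I S_def[symmetric]
  proof (rule SUP_least)
    fix r assume r: "r \<in> S"
    let ?E = "emeasure lebesgue (ellipsoidal_annulus \<delta> x r)"
    have "?E \<le> emeasure lborel (cball x (3 * CARD('n)))"
      using r \<delta> ellipsoidal_annulus_subset_cball[of \<delta> r x]
      by (simp add: S_def emeasure_mono)
    also have "\<dots> < \<infinity>" by (rule emeasure_lborel_cball_finite)
    finally obtain e where e: "?E = ennreal e" "0 \<le> e" by (cases ?E) auto
    have "ennreal (v * \<delta>) \<le> ennreal e"
      using emeasure_ellipsoidal_annulus_ge[of \<delta> r x] n \<delta> r e unfolding v_def S_def by simp
    then have "v * \<delta> \<le> e" using e by simp
    moreover have "0 < v * \<delta>" using v \<delta> by simp
    ultimately have "inverse (ennreal e) \<le> ennreal (1 / (v * \<delta>))"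
      by (subst inverse_ennreal) (auto simp: inverse_eq_divide intro!: ennreal_leI divide_left_mono mult_pos_pos)
    then have "inverse (ennreal e) * I r x \<le> ennreal (1 / (v * \<delta>)) * (\<Sum>i\<in>UNIV. N i x)"
      using I_le[OF r] by (intro mult_mono) auto
    then show "I r x / ?E \<le> ennreal (1 / (v * \<delta>)) * (\<Sum>i\<in>UNIV. N i x)"
      unfolding e divide_ennreal_def by (simp add: mult.commute)
  qed
  have N_bound: "(\<integral>\<^sup>+x. (N i x)\<^sup>2 \<partial>lborel) \<le> ennreal B * (\<integral>\<^sup>+y. (h y)\<^sup>2 \<partial>lborel)" for i
  proof -
    \<comment> \<open>Three coordinates guarantee two moving directions \<open>j\<close>,
      \<open>k\<close> besides the transversal direction \<open>i\<close>.\<close>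
    have "\<exists>j. j \<notin> {i}"
    proof (rule ccontr)
      assume "\<not> ?thesis"
      then have "(UNIV :: 'n set) \<subseteq> {i}" by auto
      then have "CARD('n) \<le> card {i}" by (intro card_mono) auto
      then show False using n by simp
    qed
    then obtain j where j: "j \<noteq> i" by auto
    have "\<exists>k. k \<notin> {i, j}"
    proof (rule ccontr)
      assume "\<not> ?thesis"
      then have "(UNIV :: 'n set) \<subseteq> {i, j}" by auto
      then have "CARD('n) \<le> card {i, j}" by (intro card_mono) auto
      then show False using n j by simp
    qed
    then obtain k where k: "k \<noteq> i" "k \<noteq> j" by auto
    show ?thesis
      unfolding N_def
    proof (rule nn_integral_square_countable_SUP_le[OF D(1) Dne])
      fix R assume "finite R" "R \<noteq> {}" "R \<subseteq> D"
      then show "(\<integral>\<^sup>+x. (SUP r\<in>R. piece_integral i \<delta> h r x)\<^sup>2 \<partial>lborel) \<le> ennreal B * (\<integral>\<^sup>+y. (h y)\<^sup>2 \<partial>lborel)"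
        unfolding B_def V_def using j k D(2)
        by (intro nn_integral_square_max_piece_integral[of i j k] \<delta> h) (auto simp: S_def)
    qed measurable
  qed
  have hf2: "(\<integral>\<^sup>+y. (h y)\<^sup>2 \<partial>lborel) = (\<integral>\<^sup>+x. (ennreal (norm (f x)))\<^sup>2 \<partial>lebesgue)"
    unfolding nn_integral_completion using hf by (intro nn_integral_cong_AE) (auto elim!: eventually_mono)
  have "(\<integral>\<^sup>+x. (ellipsoidal_maximal \<delta> f x)\<^sup>2 \<partial>lebesgue) \<le> (\<integral>\<^sup>+x. (ennreal (1 / (v * \<delta>)))\<^sup>2 * (of_nat CARD('n) * (\<Sum>i\<in>UNIV. (N i x)\<^sup>2)) \<partial>lborel)"
    unfolding nn_integral_completion
  proof (rule nn_integral_mono)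
    fix x
    have "(ellipsoidal_maximal \<delta> f x)\<^sup>2 \<le> (ennreal (1 / (v * \<delta>)) * (\<Sum>i\<in>UNIV. N i x))\<^sup>2"
      by (intro power_mono M_le) simp
    also have "\<dots> = (ennreal (1 / (v * \<delta>)))\<^sup>2 * (\<Sum>i\<in>UNIV. N i x)\<^sup>2"
      by (rule power_mult_distrib)
    also have "\<dots> \<le> (ennreal (1 / (v * \<delta>)))\<^sup>2 * (of_nat CARD('n) * (\<Sum>i\<in>UNIV. (N i x)\<^sup>2))"
      by (intro mult_left_mono sum_power2_le_card_mult) auto
    finally show "(ellipsoidal_maximal \<delta> f x)\<^sup>2 \<le> (ennreal (1 / (v * \<delta>)))\<^sup>2 * (of_nat CARD('n) * (\<Sum>i\<in>UNIV. (N i x)\<^sup>2))" .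
  qed
  also have "\<dots> = (ennreal (1 / (v * \<delta>)))\<^sup>2 * (of_nat CARD('n) * (\<Sum>i\<in>UNIV. (\<integral>\<^sup>+x. (N i x)\<^sup>2 \<partial>lborel)))"
    by (simp add: nn_integral_cmult nn_integral_sum)
  also have "\<dots> \<le> (ennreal (1 / (v * \<delta>)))\<^sup>2 * (of_nat CARD('n) * (\<Sum>i\<in>(UNIV::'n set). ennreal B * (\<integral>\<^sup>+y. (h y)\<^sup>2 \<partial>lborel)))"
    by (intro mult_left_mono sum_mono N_bound) auto
  also have "\<dots> = ennreal ((1 / (v * \<delta>))\<^sup>2 * (real CARD('n) * (real CARD('n) * B))) * (\<integral>\<^sup>+y. (h y)\<^sup>2 \<partial>lborel)"
    using B v \<delta> by (simp add: ennreal_mult ennreal_power ennreal_of_nat_eq_real_of_nat mult.assoc)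
  \<comment> \<open>The \<open>\<delta>^2\<close> in \<open>B\<close> cancels the squared
    normalisation, leaving only the logarithm. One factor \<open>CARD('n)\<close> comes from
    squaring the sum over pieces, the other from the number of pieces.\<close>
  also have "(1 / (v * \<delta>))\<^sup>2 * (real CARD('n) * (real CARD('n) * B)) = (real CARD('n))\<^sup>2 * V\<^sup>2 * (32 * CARD('n) * 260000) / v\<^sup>2 * ln (1 + 1 / \<delta>)"
    using \<delta> by (simp add: B_def power_divide power_mult_distrib power2_eq_square mult_ac)
  finally show ?thesis unfolding hf2 .
qed

text \<open>The logarithm is compared with the power \<open>2 * \<epsilon>\<close>, because passing
  from the square integral to the norm halves the exponent.\<close>

lemma ln_one_plus_inverse_le_powr:
  fixes \<delta> \<epsilon> :: real
  assumes "0 < \<delta>" "\<delta> < 1" "0 < \<epsilon>"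
  shows "ln (1 + 1 / \<delta>) \<le> 2 powr (2 * \<epsilon>) / (2 * \<epsilon>) * (\<delta> powr (- \<epsilon>))\<^sup>2"
proof -
  have "ln (1 + 1 / \<delta>) \<le> ln (2 / \<delta>)"
    using assms by (intro ln_mono) (auto simp: field_simps)
  also have "\<dots> \<le> (2 / \<delta>) powr (2 * \<epsilon>) / (2 * \<epsilon>)"
    using assms by (intro ln_powr_bound) (auto simp: field_simps)
  also have "(2 / \<delta>) powr (2 * \<epsilon>) = 2 powr (2 * \<epsilon>) * (\<delta> powr (- \<epsilon>))\<^sup>2"
  proof -
    have "(\<delta> powr (- \<epsilon>))\<^sup>2 = \<delta> powr (- (2 * \<epsilon>))"
      by (simp add: power2_eq_square flip: powr_add)
    also have "\<dots> = 1 / \<delta> powr (2 * \<epsilon>)"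
      by (rule powr_minus_divide)
    finally show ?thesis using assms by (simp add: powr_divide)
  qed
  finally show ?thesis by simp
qed

theorem theorem1p3:
  fixes \<epsilon> :: real
  assumes "CARD('n::finite) \<ge> 3" and "\<epsilon> > 0"
  shows "\<exists>C::real. C > 0 \<and>
    (\<forall>\<delta>::real. 0 < \<delta> \<longrightarrow> \<delta> < 1 \<longrightarrow>
      (\<forall>f :: real ^ 'n \<Rightarrow> complex. f \<in> L2_space \<longrightarrow>
        L2_norm (ellipsoidal_maximal \<delta> f)
          \<le> ennreal (C * \<delta> powr (- \<epsilon>)) * L2_norm (\<lambda>x. ennreal (norm (f x)))))"
proof -
  define V where "V = measure lborel (cball 0 (3 * real CARD('n) + 5) :: (real ^ 'n) set)"
  define v where "v = measure lborel (cball 0 1 :: (real ^ 'n) set)"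
  define A where "A = (real CARD('n))\<^sup>2 * V\<^sup>2 * (32 * CARD('n) * 260000) / v\<^sup>2"
  \<comment> \<open>The square root of the constant for square integrals, including the factor lost
    in bounding the logarithm by a power.\<close>
  define C where "C = sqrt (A * (2 powr (2 * \<epsilon>) / (2 * \<epsilon>)))"
  have "0 < V" "0 < v"
    unfolding V_def v_def by (intro content_cball_pos[unfolded measure_completion]; simp)+
  then have A: "0 < A" unfolding A_def using assms by auto
  then have C: "0 < C" unfolding C_def using assms by simp
  have "L2_norm (ellipsoidal_maximal \<delta> f) \<le> ennreal (C * \<delta> powr (- \<epsilon>)) * L2_norm (\<lambda>x. ennreal (norm (f x)))"
    if \<delta>: "0 < \<delta>" "\<delta> < 1" and f: "f \<in> L2_space" for \<delta> and f :: "real ^ 'n \<Rightarrow> complex"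
  proof -
    define H where "H = (\<integral>\<^sup>+x. (ennreal (norm (f x)))\<^sup>2 \<partial>lebesgue)"
    have "H = (\<integral>\<^sup>+x. ennreal ((norm (f x))\<^sup>2) \<partial>lebesgue)"
      by (simp add: H_def ennreal_power)
    also have "\<dots> < \<infinity>"
      using f by (auto simp: L2_space_def integrable_iff_bounded)
    finally obtain H' where H': "H = ennreal H'" "0 \<le> H'" by (cases H) auto
    define J where "J = (\<integral>\<^sup>+x. (ellipsoidal_maximal \<delta> f x)\<^sup>2 \<partial>lebesgue)"
    have "J \<le> ennreal (A * ln (1 + 1 / \<delta>)) * H"
      unfolding J_def H_def A_def V_def v_def
      using f by (intro nn_integral_square_ellipsoidal_maximal assms \<delta>) (simp add: L2_space_def)
    also have "\<dots> \<le> ennreal ((C * \<delta> powr (- \<epsilon>))\<^sup>2) * H"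
    proof (intro mult_right_mono ennreal_leI)
      have "A * ln (1 + 1 / \<delta>) \<le> A * (2 powr (2 * \<epsilon>) / (2 * \<epsilon>) * (\<delta> powr (- \<epsilon>))\<^sup>2)"
        using A by (intro mult_left_mono ln_one_plus_inverse_le_powr \<delta> assms) auto
      also have "\<dots> = (C * \<delta> powr (- \<epsilon>))\<^sup>2"
        using A assms by (simp add: C_def power_mult_distrib)
      finally show "A * ln (1 + 1 / \<delta>) \<le> (C * \<delta> powr (- \<epsilon>))\<^sup>2" .
    qed simp
    also have "\<dots> = ennreal ((C * \<delta> powr (- \<epsilon>))\<^sup>2 * H')"
      unfolding H' by (rule ennreal_mult[symmetric]) (use H' in auto)
    finally have J: "J \<le> ennreal ((C * \<delta> powr (- \<epsilon>))\<^sup>2 * H')" .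
    \<comment> \<open>Both square integrals are finite, so \<open>sqrt_ennreal\<close> takes its
      real branch on each side.\<close>
    then obtain J' where J': "J = ennreal J'" "0 \<le> J'"
      by (cases J) (auto simp: top_unique)
    have "J' \<le> (C * \<delta> powr (- \<epsilon>))\<^sup>2 * H'"
      using J H' J' by simp
    then have "sqrt J' \<le> sqrt ((C * \<delta> powr (- \<epsilon>))\<^sup>2 * H')" by (rule real_sqrt_le_mono)
    also have "\<dots> = (C * \<delta> powr (- \<epsilon>)) * sqrt H'"
      using C by (simp add: real_sqrt_mult)
    finally have "ennreal (sqrt J') \<le> ennreal ((C * \<delta> powr (- \<epsilon>)) * sqrt H')" by (rule ennreal_leI)
    also have "\<dots> = ennreal (C * \<delta> powr (- \<epsilon>)) * ennreal (sqrt H')"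
      using C H' by (intro ennreal_mult) auto
    finally show ?thesis
      unfolding L2_norm_def sqrt_ennreal_def J_def[symmetric] H_def[symmetric] using H' J' by simp
  qed
  then show ?thesis using C by blast
qed

end
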